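(* Let $(b_n)_{n\ge 0},(c_n)_{n\ge 0}\in\ell^2(\mathbb{Z}_+;\mathbb{C})$ be sequences depending holomorphically on the spectral parameter $\lambda\in\mathbb{C}\setminus[-2\mathrm{i},2\mathrm{i}]$. Then the four functions $\det(I-K_\lambda^+)$, $\det(I-\mathcal{T}_\lambda^+)$, $\mathcal{E}^+(\lambda)$ and $\mathcal{F}^+(\lambda)$ defined in the context are holomorphic in $\lambda\in\mathbb{C}\setminus[-2\mathrm{i},2\mathrm{i}]$ and are equal: $$\det(I-K_\lambda^+)=\det(I-\mathcal{T}_\lambda^+)=\mathcal{E}^+(\lambda)=\mathcal{F}^+(\lambda).$$ As a result, $\lambda\in\mathbb{C}\setminus[-2\mathrm{i},2\mathrm{i}]$ is a simple discrete eigenvalue of the boundary value problem $$z_{n-1}-z_{n+1}+b_nc_nz_n=\lambda z_n,\quad n\ge 0,\qquad z_{-1}=0,$$ if and only if $\lambda$ is a zero of each of these four functions.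
   Context: Notation: $\mathbb{Z}_+=\{0,1,2,\dots\}$. The sequences $b=(b_n)$, $c=(c_n)$ may depend on $\lambda$ (holomorphically, as $\ell^2$-valued maps; constant sequences are allowed). Consider (E) $z_{n-1}-z_{n+1}+b_nc_nz_n=\lambda z_n$, $n\ge0$, and (BC) $z_{-1}=0$. A number $\lambda\notin[-2\mathrm{i},2\mathrm{i}]$ is an eigenvalue of (E)-(BC) if there is a nonzero $(z_n)_{n\ge0}\in\ell^2(\mathbb{Z}_+;\mathbb{C})$ which, together with $z_{-1}=0$, satisfies (E). Eigenvalues off $[-2\mathrm{i},2\mathrm{i}]$ are called isolated or discrete; "simple" means that the space of such solutions is one-dimensional. Let $S:(z_0,z_1,\dots)\mapsto(0,z_0,z_1,\dots)$ be the right shift and $S^{-1}:=S^*:(z_0,z_1,\dots)\mapsto(z_1,z_2,\dots)$ the left shift on $\ell^2(\mathbb{Z}_+;\mathbb{C})$; $S^{-1}$ also denotes the left shift on vector-valued sequences. The operator $S-S^{-1}-\lambda$ is invertible on $\ell^2(\mathbb{Z}_+;\mathbb{C})$ for $\lambda\notin[-2\mathrm{i},2\mathrm{i}]$. Matrices: $A=A(\lambda)=\begin{bmatrix}-\lambda&1\\1&0\end{bmatrix}$, $Q_+=\begin{bmatrix}1&0\\0&0\end{bmatrix}$, $B_n=b_nQ_+$, $C_n=c_nQ_+$, $A_n^\times=A+B_nC_n=\begin{bmatrix}b_nc_n-\lambda&1\\1&0\end{bmatrix}$. For $\lambda\notin[-2\mathrm{i},2\mathrm{i}]$ let $\mu_\pm=\mu_\pm(\lambda)$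 be the roots of $\mu^2+\lambda\mu-1=0$ (the eigenvalues of $A$) with $|\mu_+|<1<|\mu_-|$. Let $P_+=P_+(\lambda)$ be the spectral projection of $A(\lambda)$ in $\mathbb{C}^2$ corresponding to $\mu_+$. Let $R_+=R_+(\lambda)$ be the projection in $\mathbb{C}^2$ onto $\operatorname{ran}P_+$ parallel to $\operatorname{ran}Q_+$, and $R_-=I_{2\times2}-R_+$. (1) $K_\lambda^+=-\operatorname{diag}_{n\in\mathbb{Z}_+}\{c_n\}\,(S-S^{-1}-\lambda)^{-1}\operatorname{diag}_{n\in\mathbb{Z}_+}\{b_n\}$, a trace class operator on $\ell^2(\mathbb{Z}_+;\mathbb{C})$; $\det(I-K^+_\lambda)$ is the Fredholm determinant. (2) Let $\ell^2_{\operatorname{ran}Q_+}(\mathbb{Z}_+;\mathbb{C}^2)=\{(y_n)_{n\ge0}\in\ell^2(\mathbb{Z}_+;\mathbb{C}^2):y_0\in\operatorname{ran}Q_+\}$. For $\lambda\notin[-2\mathrm{i},2\mathrm{i}]$ the operator $S^{-1}-\operatorname{diag}_{n\in\mathbb{Z}_+}\{A\}$ is invertible from $\ell^2_{\operatorname{ran}Q_+}(\mathbb{Z}_+;\mathbb{C}^2)$ onto $\ell^2(\mathbb{Z}_+;\mathbb{C}^2)$; with this inverse define $\mathcal{T}_\lambda^+=\operatorname{diag}_{n\in\mathbb{Z}_+}\{C_n\}\big(S^{-1}-\operatorname{diag}_{n\in\mathbb{Z}_+}\{A\}\big)^{-1}\operatorname{diag}_{n\in\mathbb{Z}_+}\{B_n\}$,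 a trace class operator on $\ell^2(\mathbb{Z}_+;\mathbb{C}^2)$; $\det(I-\mathcal{T}^+_\lambda)$ is the Fredholm determinant. (3) The matrix-valued Jost solution $(Y_n^+)_{n\ge0}$, $Y_n^+=Y_n^+(\lambda)\in\mathbb{C}^{2\times2}$, is the unique solution of $Y_{n+1}=A_n^\times Y_n$, $n\ge0$, such that $\|(\mu_+)^{-n}(Y_n^+-A^nR_+)\|\to0$ as $n\to+\infty$ and $Y_0^+=Y_0^+R_+$. The Evans function is $\mathcal{E}^+(\lambda)=\det\big(Y_0^+(\lambda)+R_-(\lambda)\big)$. (4) The Jost solution $\mathbf{z}^+=(z_n^+)_{n\ge-1}$ is the unique solution of (E) (without (BC)) such that $(\mu_+)^{-n}z_n^+\to1$ as $n\to+\infty$. The regular solution $\mathbf{z}^{\mathrm r}=(z_n^{\mathrm r})_{n\ge-1}$ is the solution of (E) with $z_{-1}^{\mathrm r}=0$, $z_0^{\mathrm r}=1$. For sequences $\mathbf u=(u_n)_{n\ge-1}$, $\mathbf v=(v_n)_{n\ge-1}$ put $\mathcal{W}(\mathbf u,\mathbf v)_n=(-1)^{n}(u_{n-1}v_n-u_nv_{n-1})$, $n\ge0$; thus $\mathcal{W}(\mathbf z^+,\mathbf z^{\mathrm r})_0=z_{-1}^+(\lambda)$. The Jost function is $\mathcal{F}^+(\lambda)=\mu_+(\lambda)\,\mathcal{W}(\mathbf z^+(\lambda),\mathbf z^{\mathrm r}(\lambda))_0=\mu_+(\lambda)z^+_{-1}(\lambda)$. *)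

theory Defs
  imports "HOL-Complex_Analysis.Complex_Analysis"
begin

section \<open>The spaces \<open>\<ell>\<^sup>2(\<int>\<^sub>+; V)\<close>, trace class operators and Fredholm determinants\<close>

definition ell2 :: "(nat \<Rightarrow> 'v::real_normed_vector) set" where
  "ell2 = {x. summable (\<lambda>n. (norm (x n))\<^sup>2)}"

definition ell2_norm :: "(nat \<Rightarrow> 'v::real_normed_vector) \<Rightarrow> real" where
  "ell2_norm x = sqrt (\<Sum>n. (norm (x n))\<^sup>2)"

definition ell2_holomorphic_on :: "(complex \<Rightarrow> nat \<Rightarrow> complex) \<Rightarrow> complex set \<Rightarrow> bool" where
  "ell2_holomorphic_on f U \<longleftrightarrow>
     (\<forall>w\<in>U. f w \<in> ell2) \<and>
     (\<forall>w\<in>U. \<exists>d\<in>ell2.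
        ((\<lambda>v. ell2_norm (\<lambda>n. (f v n - f w n) / (v - w) - d n)) \<longlongrightarrow> 0) (at w within U))"

text \<open>Inner products (linear in the first argument) on \<open>\<ell>\<^sup>2(\<int>\<^sub>+; \<complex>)\<close> and
  \<open>\<ell>\<^sup>2(\<int>\<^sub>+; \<complex>\<^sup>2)\<close>, with the standard orthonormal bases, indexed by \<^typ>\<open>nat\<close> and
  \<^typ>\<open>nat \<times> 2\<close>. The library has no complex inner product spaces, so the notions below
  take the inner product and an orthonormal basis as arguments.\<close>

definition inner_C :: "(nat \<Rightarrow> complex) \<Rightarrow> (nat \<Rightarrow> complex) \<Rightarrow> complex" where
  "inner_C x y = (\<Sum>n. x n * cnj (y n))"

definition basis_C :: "nat \<Rightarrow> nat \<Rightarrow> complex" where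
  "basis_C j = (\<lambda>n. if n = j then 1 else 0)"

definition inner_C2 :: "(nat \<Rightarrow> complex^2) \<Rightarrow> (nat \<Rightarrow> complex^2) \<Rightarrow> complex" where
  "inner_C2 x y = (\<Sum>n. \<Sum>k\<in>UNIV. x n $ k * cnj (y n $ k))"

definition basis_C2 :: "nat \<times> 2 \<Rightarrow> nat \<Rightarrow> complex^2" where
  "basis_C2 jk = (\<lambda>n. if n = fst jk then axis (snd jk) 1 else 0)"

text \<open>Operators are functions on all sequences of which only the restriction to \<^const>\<open>ell2\<close>
  matters. An operator is trace class iff it is a sum of rank one operators
  \<open>x \<mapsto> \<langle>x, f\<^sub>k\<rangle> g\<^sub>k\<close> whose norms \<open>\<parallel>f\<^sub>k\<parallel> \<parallel>g\<^sub>k\<parallel>\<close> are summable (the series then converges in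
  operator norm, so it may be tested weakly).\<close>

definition trace_class ::
  "((nat \<Rightarrow> 'v::real_normed_vector) \<Rightarrow> (nat \<Rightarrow> 'v) \<Rightarrow> complex) \<Rightarrow>
   ((nat \<Rightarrow> 'v) \<Rightarrow> (nat \<Rightarrow> 'v)) \<Rightarrow> bool" where
  "trace_class ip T \<longleftrightarrow>
     (\<forall>x\<in>ell2. T x \<in> ell2) \<and>
     (\<exists>f g :: nat \<Rightarrow> nat \<Rightarrow> 'v.
        (\<forall>k. f k \<in> ell2 \<and> g k \<in> ell2) \<and>
        summable (\<lambda>k. ell2_norm (f k) * ell2_norm (g k)) \<and>
        (\<forall>x\<in>ell2. \<forall>y\<in>ell2. (\<lambda>k. ip x (f k) * ip (g k) y) sums ip (T x) y))"

definition principal_minor :: "('i \<Rightarrow> 'i \<Rightarrow> complex) \<Rightarrow> 'i set \<Rightarrow> complex" where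
  "principal_minor M F = (\<Sum>p | p permutes F. of_int (sign p) * (\<Prod>i\<in>F. M i (p i)))"

text \<open>The trace of the exterior power \<open>\<Lambda>\<^sup>k T\<close>, evaluated in the orthonormal basis
  \<open>e\<^sub>i\<^sub>1 \<and> \<dots> \<and> e\<^sub>i\<^sub>k\<close> of \<open>\<Lambda>\<^sup>k(\<ell>\<^sup>2)\<close>, one vector for each \<open>k\<close>-element set of indices.\<close>

definition trace_ext_power ::
  "('h \<Rightarrow> 'h \<Rightarrow> complex) \<Rightarrow> ('i \<Rightarrow> 'h) \<Rightarrow> nat \<Rightarrow> ('h \<Rightarrow> 'h) \<Rightarrow> complex" where
  "trace_ext_power ip e k T =
     (\<Sum>\<^sub>\<infinity>F\<in>{F. finite F \<and> card F = k}. principal_minor (\<lambda>i j. ip (T (e j)) (e i)) F)"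

text \<open>The Fredholm determinant \<open>det(I - T) = \<Sum>\<^sub>k (-1)\<^sup>k tr(\<Lambda>\<^sup>k T)\<close>, left unspecified when
  \<open>T\<close> is not trace class.\<close>

definition fredholm_det_I_minus ::
  "((nat \<Rightarrow> 'v::real_normed_vector) \<Rightarrow> (nat \<Rightarrow> 'v) \<Rightarrow> complex) \<Rightarrow> ('i \<Rightarrow> nat \<Rightarrow> 'v) \<Rightarrow>
   ((nat \<Rightarrow> 'v) \<Rightarrow> (nat \<Rightarrow> 'v)) \<Rightarrow> complex" where
  "fredholm_det_I_minus ip e T =
     (if trace_class ip T then (\<Sum>k. (- 1) ^ k * trace_ext_power ip e k T) else undefined)"

section \<open>The difference equation and its discrete eigenvalues\<close>

definition off_cut :: "complex set" where
  "off_cut = - closed_segment (- 2 * \<i>) (2 * \<i>)"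

text \<open>Sequences \<open>(z\<^sub>n)\<close> with \<open>n \<ge> -1\<close> are functions on \<^typ>\<open>int\<close> normalised by
  \<^const>\<open>extensional\<close> to be \<^const>\<open>undefined\<close> below \<open>-1\<close>, so that solutions can be unique.\<close>

definition solves_E ::
  "(nat \<Rightarrow> complex) \<Rightarrow> (nat \<Rightarrow> complex) \<Rightarrow> complex \<Rightarrow> (int \<Rightarrow> complex) \<Rightarrow> bool" where
  "solves_E b c l z \<longleftrightarrow> z \<in> extensional {- 1..} \<and>
     (\<forall>n::nat. z (int n - 1) - z (int n + 1) + b n * c n * z (int n) = l * z (int n))"

definition solution_space ::
  "(nat \<Rightarrow> complex) \<Rightarrow> (nat \<Rightarrow> complex) \<Rightarrow> complex \<Rightarrow> (nat \<Rightarrow> complex) set" where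
  "solution_space b c l =
     {z \<in> ell2. \<exists>u. solves_E b c l u \<and> u (- 1) = 0 \<and> (\<forall>n. u (int n) = z n)}"

definition discrete_eigenvalue :: "(nat \<Rightarrow> complex) \<Rightarrow> (nat \<Rightarrow> complex) \<Rightarrow> complex \<Rightarrow> bool" where
  "discrete_eigenvalue b c l \<longleftrightarrow> l \<in> off_cut \<and> (\<exists>z\<in>solution_space b c l. z \<noteq> (\<lambda>n. 0))"

definition simple_discrete_eigenvalue ::
  "(nat \<Rightarrow> complex) \<Rightarrow> (nat \<Rightarrow> complex) \<Rightarrow> complex \<Rightarrow> bool" where
  "simple_discrete_eigenvalue b c l \<longleftrightarrow> discrete_eigenvalue b c l \<and>
     (\<exists>v. v \<noteq> (\<lambda>n. 0) \<and> solution_space b c l = range (\<lambda>a n. a * v n))"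

section \<open>The operators \<open>K\<^sub>\<lambda>\<^sup>+\<close> and \<open>T\<^sub>\<lambda>\<^sup>+\<close>\<close>

definition right_shift :: "(nat \<Rightarrow> complex) \<Rightarrow> nat \<Rightarrow> complex" where
  "right_shift z = (\<lambda>n. case n of 0 \<Rightarrow> 0 | Suc m \<Rightarrow> z m)"

definition left_shift :: "(nat \<Rightarrow> 'v) \<Rightarrow> nat \<Rightarrow> 'v" where
  "left_shift z = (\<lambda>n. z (Suc n))"

definition K_plus ::
  "(nat \<Rightarrow> complex) \<Rightarrow> (nat \<Rightarrow> complex) \<Rightarrow> complex \<Rightarrow> (nat \<Rightarrow> complex) \<Rightarrow> (nat \<Rightarrow> complex)" where
  "K_plus b c l x =
     (\<lambda>n. - c n * inv_into ell2 (\<lambda>z m. right_shift z m - left_shift z m - l * z m)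
                    (\<lambda>m. b m * x m) n)"

definition A_mat :: "complex \<Rightarrow> complex^2^2" where
  "A_mat l = vector [vector [- l, 1], vector [1, 0]]"

definition Q_plus :: "complex^2^2" where
  "Q_plus = vector [vector [1, 0], vector [0, 0]]"

text \<open>\<^term>\<open>mat a ** M\<close> is the scalar multiple \<open>a M\<close>; \<open>B\<^sub>n\<close> and \<open>C\<^sub>n\<close> are
  \<^term>\<open>scaled_Q (b n)\<close> and \<^term>\<open>scaled_Q (c n)\<close>.\<close>

definition scaled_Q :: "complex \<Rightarrow> complex^2^2" where
  "scaled_Q a = mat a ** Q_plus"

definition ell2_ran_Q :: "(nat \<Rightarrow> complex^2) set" where
  "ell2_ran_Q = {y \<in> ell2. y 0 \<in> range ((*v) Q_plus)}"

definition T_plus ::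
  "(nat \<Rightarrow> complex) \<Rightarrow> (nat \<Rightarrow> complex) \<Rightarrow> complex \<Rightarrow> (nat \<Rightarrow> complex^2) \<Rightarrow> (nat \<Rightarrow> complex^2)" where
  "T_plus b c l x =
     (\<lambda>n. scaled_Q (c n) *v
        inv_into ell2_ran_Q (\<lambda>y m. left_shift y m - A_mat l *v y m)
          (\<lambda>m. scaled_Q (b m) *v x m) n)"

section \<open>The Evans function\<close>

definition mu_plus :: "complex \<Rightarrow> complex" where
  "mu_plus l = (THE m. m\<^sup>2 + l * m - 1 = 0 \<and> cmod m < 1)"

definition mu_minus :: "complex \<Rightarrow> complex" where
  "mu_minus l = (THE m. m\<^sup>2 + l * m - 1 = 0 \<and> cmod m > 1)"

definition projection_onto_along :: "(complex^2) set \<Rightarrow> (complex^2) set \<Rightarrow> complex^2^2" where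
  "projection_onto_along U V =
     (THE P. P ** P = P \<and> range ((*v) P) = U \<and> {v. P *v v = 0} = V)"

text \<open>The two eigenvalues of \<^term>\<open>A_mat l\<close> are distinct, so the spectral projection for
  \<^term>\<open>mu_plus l\<close> is the projection onto its eigenspace along the other eigenspace.\<close>

definition P_plus :: "complex \<Rightarrow> complex^2^2" where
  "P_plus l = projection_onto_along
     {v. A_mat l *v v = mu_plus l *s v} {v. A_mat l *v v = mu_minus l *s v}"

definition R_plus :: "complex \<Rightarrow> complex^2^2" where
  "R_plus l = projection_onto_along (range ((*v) (P_plus l))) (range ((*v) Q_plus))"

definition R_minus :: "complex \<Rightarrow> complex^2^2" where
  "R_minus l = mat 1 - R_plus l"

definition A_cross :: "(nat \<Rightarrow> complex) \<Rightarrow> (nat \<Rightarrow> complex) \<Rightarrow> complex \<Rightarrow> nat \<Rightarrow> complex^2^2" where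
  "A_cross b c l n = A_mat l + scaled_Q (b n) ** scaled_Q (c n)"

text \<open>The matrix product \<open>A\<^sup>n R\<^sub>+\<close> is written as an iterate, since the library's power on
  \<^typ>\<open>complex^2^2\<close> would be entrywise.\<close>

definition matrix_jost ::
  "(nat \<Rightarrow> complex) \<Rightarrow> (nat \<Rightarrow> complex) \<Rightarrow> complex \<Rightarrow> nat \<Rightarrow> complex^2^2" where
  "matrix_jost b c l = (THE Y.
     (\<forall>n. Y (Suc n) = A_cross b c l n ** Y n) \<and>
     (\<lambda>n. norm (mat (inverse (mu_plus l) ^ n) **
                 (Y n - ((\<lambda>M. A_mat l ** M) ^^ n) (R_plus l)))) \<longlonglongrightarrow> 0 \<and>
     Y 0 = Y 0 ** R_plus l)"

definition evans_plus :: "(nat \<Rightarrow> complex) \<Rightarrow> (nat \<Rightarrow> complex) \<Rightarrow> complex \<Rightarrow> complex" where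
  "evans_plus b c l = det (matrix_jost b c l 0 + R_minus l)"

section \<open>The Jost function\<close>

definition jost_solution ::
  "(nat \<Rightarrow> complex) \<Rightarrow> (nat \<Rightarrow> complex) \<Rightarrow> complex \<Rightarrow> int \<Rightarrow> complex" where
  "jost_solution b c l = (THE z. solves_E b c l z \<and>
     (\<lambda>n. inverse (mu_plus l) ^ n * z (int n)) \<longlonglongrightarrow> 1)"

definition regular_solution ::
  "(nat \<Rightarrow> complex) \<Rightarrow> (nat \<Rightarrow> complex) \<Rightarrow> complex \<Rightarrow> int \<Rightarrow> complex" where
  "regular_solution b c l = (THE z. solves_E b c l z \<and> z (- 1) = 0 \<and> z 0 = 1)"

definition wronskian :: "(int \<Rightarrow> complex) \<Rightarrow> (int \<Rightarrow> complex) \<Rightarrow> nat \<Rightarrow> complex" where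
  "wronskian u v n =
     (- 1) ^ n * (u (int n - 1) * v (int n) - u (int n) * v (int n - 1))"

definition jost_plus :: "(nat \<Rightarrow> complex) \<Rightarrow> (nat \<Rightarrow> complex) \<Rightarrow> complex \<Rightarrow> complex" where
  "jost_plus b c l =
     mu_plus l * wronskian (jost_solution b c l) (regular_solution b c l) 0"

section \<open>The two determinants\<close>

definition det_K_plus :: "(nat \<Rightarrow> complex) \<Rightarrow> (nat \<Rightarrow> complex) \<Rightarrow> complex \<Rightarrow> complex" where
  "det_K_plus b c l = fredholm_det_I_minus inner_C basis_C (K_plus b c l)"

definition det_T_plus :: "(nat \<Rightarrow> complex) \<Rightarrow> (nat \<Rightarrow> complex) \<Rightarrow> complex \<Rightarrow> complex" where
  "det_T_plus b c l = fredholm_det_I_minus inner_C2 basis_C2 (T_plus b c l)"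

end

theory Submission
  imports Defs
begin

text \<open>
  Fix \<open>\<lambda>\<close> off the cut, let \<open>\<mu> = \<mu>\<^sub>+(\<lambda>)\<close> and \<open>v\<^sub>n = b\<^sub>n c\<^sub>n\<close>, a summable sequence. The four
  functions agree because each of them equals one number \<open>jost_fun v\<close>, and the bridge between
  determinants and solutions is an explicit formula for the minors of a Green kernel.

  The inverse of \<open>S - S\<^sup>-\<^sup>1 - \<lambda>\<close> has, up to signs, the kernel \<open>\<mu>\<^bsup>max+1\<^esup> h\<^bsub>min+1\<^esub>\<close>, where \<open>h\<close> is the
  regular solution of the free equation. A kernel of this shape can be eliminated one row at a
  time, so that a principal minor over \<open>n\<^sub>1 < \<dots> < n\<^sub>k\<close> is a product over consecutive pairs
  (\<open>principal_minor_insert_green\<close>). This has two consequences for the matrix of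
  \<open>K\<^sub>\<lambda>\<^sup>+\<close>. Its minor over \<open>F\<close> is at most \<open>\<Prod>\<^bsub>n\<in>F\<^esub> C \<bar>v\<^sub>n\<bar>\<close> (\<open>norm_minor_le\<close>), so the Fredholm
  series converges absolutely over all finite \<open>F\<close> and is the limit of its partial sums over
  \<open>F \<subseteq> {0,\<dots>,N-1}\<close>. And when the sets \<open>F\<close> are sorted by their largest element, these partial
  sums become the Volterra series of the regular solution \<open>z\<^sup>r\<close>: they equal \<open>\<mu>\<close> times the
  Wronskian at \<open>N\<close> of \<open>\<mu>\<^sup>n\<close> and \<open>z\<^sup>r\<close>, here called \<open>jost_trunc\<close>
  (\<open>sum_minor_eq_jost_trunc\<close>). Their limit \<open>jost_fun v\<close> is therefore \<open>det(I - K\<^sub>\<lambda>\<^sup>+)\<close>.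

  The truncated Wronskians satisfy a three-term relation under the left shift of \<open>v\<close>, and
  \<open>jost_fun\<close> inherits it. Hence \<open>\<mu>\<^sup>n jost_fun (S\<^bsup>-(n+1)\<^esup> v)\<close> solves (E); by the bound on the minors
  \<open>jost_fun\<close> tends to 1 along the tails of \<open>v\<close>, so this is the Jost solution and
  \<open>\<mu> z\<^sup>+\<^sub>-\<^sub>1 = jost_fun v\<close>. Uniqueness of the Jost solution follows from the constancy of the
  Wronskian. In the two-dimensional picture \<open>R\<^sub>+\<close> has the columns \<open>0\<close> and \<open>(\<mu>, 1)\<close>, and the
  matrix-valued Jost solution has the columns \<open>0\<close> and \<open>\<mu> (z\<^sup>+\<^sub>n, z\<^sup>+\<^sub>n\<^sub>-\<^sub>1)\<close>, which gives the Evans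
  function; \<open>T\<^sub>\<lambda>\<^sup>+\<close> acts as \<open>K\<^sub>\<lambda>\<^sup>+\<close> on first components and as zero on second ones.

  A nonzero square summable solution with \<open>z\<^sub>-\<^sub>1 = 0\<close> has vanishing Wronskian with the Jost solution, so
  one exists precisely when \<open>z\<^sup>+\<^sub>-\<^sub>1 = 0\<close>, and it is then unique up to a factor.

  Finally \<open>jost_trunc\<close> is a polynomial in holomorphic functions of \<open>\<lambda>\<close>, and it converges to
  \<open>jost_fun\<close> locally uniformly because the tails of holomorphic \<open>\<ell>\<^sup>2\<close>-valued maps are locally
  uniformly small.
\<close>

text \<open>Coefficients of formal power series share the symbol \<open>$\<close> with components of vectors, which makes
  terms with several components ambiguous.\<close>

no_notation fps_nth (infixl "$" 75)

section \<open>Principal minors\<close>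

lemma principal_minor_cong:
  assumes "\<And>i j. i \<in> F \<Longrightarrow> j \<in> F \<Longrightarrow> M i j = M' i j"
  shows "principal_minor M F = principal_minor M' F"
  unfolding principal_minor_def
  by (intro sum.cong refl arg_cong2[where f = "(*)"] prod.cong)
     (use assms in \<open>auto dest: permutes_in_image\<close>)

lemma principal_minor_empty [simp]: "principal_minor M {} = 1"
  by (simp add: principal_minor_def sign_id id_def[symmetric])

lemma principal_minor_zero_row:
  assumes "finite F" "k \<in> F" "\<And>j. j \<in> F \<Longrightarrow> M k j = 0"
  shows "principal_minor M F = 0"
  unfolding principal_minor_def
proof (rule sum.neutral, safe)
  fix p assume "p permutes F"
  then have "M k (p k) = 0" using assms by (simp add: permutes_in_image)
  then have "(\<Prod>i\<in>F. M i (p i)) = 0" using assms(1,2) by (metis prod_zero)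
  then show "of_int (sign p) * (\<Prod>i\<in>F. M i (p i)) = 0" by simp
qed

lemma principal_minor_scale:
  assumes "finite F"
  shows "principal_minor (\<lambda>i j. c i * d j * M i j) F = (\<Prod>i\<in>F. c i * d i) * principal_minor M F"
proof -
  have "(\<Prod>i\<in>F. c i * d (p i) * M i (p i)) = (\<Prod>i\<in>F. c i * d i) * (\<Prod>i\<in>F. M i (p i))"
    if "p permutes F" for p
    using prod.permute[OF that, of d] by (simp add: prod.distrib o_def)
  then show ?thesis
    unfolding principal_minor_def sum_distrib_left by (intro sum.cong) (auto simp: mult_ac)
qed

text \<open>Relabelling the indices conjugates the permutations, which preserves their signs.\<close>

lemma principal_minor_image:
  assumes "inj_on f F" "finite F"
  shows "principal_minor M (f ` F) = principal_minor (\<lambda>i j. M (f i) (f j)) F"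
proof -
  let ?m = "map_permutation F f"
  have bij: "bij_betw f F (f ` F)" using assms(1) by (rule inj_on_imp_bij_betw)
  have bb: "bij_betw ?m {p. p permutes F} {p. p permutes f ` F}"
  proof (rule bij_betw_byWitness[where f' = "map_permutation (f ` F) (inv_into F f)"])
    show "\<forall>p\<in>{p. p permutes F}. map_permutation (f ` F) (inv_into F f) (?m p) = p"
      using map_permutation_compose_inv[OF bij] assms(1) by simp
    have bij': "bij_betw (inv_into F f) (f ` F) F" using bij by (rule bij_betw_inv_into)
    show "\<forall>p\<in>{p. p permutes f ` F}. ?m (map_permutation (f ` F) (inv_into F f) p) = p"
      using map_permutation_compose_inv[OF bij', of _ f] by (simp add: f_inv_into_f)
    show "?m ` {p. p permutes F} \<subseteq> {p. p permutes f ` F}"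
      using map_permutation_permutes[OF bij] by auto
    show "map_permutation (f ` F) (inv_into F f) ` {p. p permutes f ` F} \<subseteq> {p. p permutes F}"
      using map_permutation_permutes[OF bij'] by auto
  qed
  show ?thesis unfolding principal_minor_def
    by (rule sum.reindex_bij_betw[OF bb, symmetric, THEN trans], rule sum.cong)
       (use assms in \<open>auto simp: sign_map_permutation prod.reindex map_permutation_apply\<close>)
qed

text \<open>Composing with the transposition of the two rows is a sign-reversing involution on the
  terms.\<close>

lemma principal_minor_equal_rows:
  assumes "a \<in> F" "b \<in> F" "a \<noteq> b" "finite F" "\<And>j. j \<in> F \<Longrightarrow> M a j = M b j"
  shows "principal_minor M F = 0"
proof -
  let ?t = "Transposition.transpose a b"
  have tp: "?t permutes F" using assms by (simp add: permutes_swap_id)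
  have "principal_minor M F = (\<Sum>p | p permutes F. of_int (sign (p \<circ> ?t)) * (\<Prod>i\<in>F. M i ((p \<circ> ?t) i)))"
    unfolding principal_minor_def by (rule sum_permutations_compose_right[OF tp])
  also have "\<dots> = (\<Sum>p | p permutes F. - (of_int (sign p) * (\<Prod>i\<in>F. M i (p i))))"
  proof (rule sum.cong[OF refl])
    fix p assume "p \<in> {p. p permutes F}"
    then have p: "p permutes F" by simp
    have s: "sign (p \<circ> ?t) = - sign p"
      using p assms(3,4) permutes_imp_permutation
      by (subst sign_compose) (auto simp: sign_swap_id permutation_swap_id)
    have "(\<Prod>i\<in>F. M i ((p \<circ> ?t) i)) = (\<Prod>i\<in>F. M (?t i) (p (?t i)))"
    proof (rule prod.cong[OF refl])
      fix i assume "i \<in> F"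
      then have "p (?t i) \<in> F" using p tp by (metis permutes_in_image)
      then show "M i ((p \<circ> ?t) i) = M (?t i) (p (?t i))"
        using assms(5) by (auto simp: Transposition.transpose_def)
    qed
    also have "\<dots> = (\<Prod>i\<in>F. M i (p i))"
      using prod.permute[OF tp, of "\<lambda>i. M i (p i)"] by (simp add: o_def)
    finally show "of_int (sign (p \<circ> ?t)) * (\<Prod>i\<in>F. M i ((p \<circ> ?t) i)) = - (of_int (sign p) * (\<Prod>i\<in>F. M i (p i)))"
      by (simp add: s)
  qed
  finally have "principal_minor M F = - principal_minor M F"
    by (simp add: principal_minor_def sum_negf)
  then show ?thesis by (simp add: eq_neg_iff_add_eq_0)
qed

lemma principal_minor_row_add:
  assumes "a \<in> F" "b \<in> F" "a \<noteq> b" "finite F"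
  shows "principal_minor (\<lambda>i j. if i = a then M a j + t * M b j else M i j) F = principal_minor M F"
proof -
  (* multilinearity in row a; the second summand has two equal rows *)
  let ?N = "\<lambda>i j. if i = a then M b j else M i j"
  have "(\<Prod>i\<in>F. if i = a then M a (p i) + t * M b (p i) else M i (p i)) =
        (\<Prod>i\<in>F. M i (p i)) + t * (\<Prod>i\<in>F. ?N i (p i))" for p
  proof -
    have "(\<Prod>i\<in>F - {a}. if i = a then M a (p i) + t * M b (p i) else M i (p i)) = (\<Prod>i\<in>F - {a}. M i (p i))"
      "(\<Prod>i\<in>F - {a}. ?N i (p i)) = (\<Prod>i\<in>F - {a}. M i (p i))"
      by (auto intro!: prod.cong)
    then show ?thesis using assms(1,4)
      by (simp add: prod.remove[of F a] ring_distribs)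
  qed
  then have "principal_minor (\<lambda>i j. if i = a then M a j + t * M b j else M i j) F =
      principal_minor M F + t * principal_minor ?N F"
    unfolding principal_minor_def
    by (simp add: ring_distribs sum.distrib sum_distrib_left mult_ac)
  also have "principal_minor ?N F = 0"
    using assms by (intro principal_minor_equal_rows[of a F b]) auto
  finally show ?thesis by simp
qed

lemma principal_minor_insert_corner:
  assumes "finite F" "k \<notin> F" "\<And>j. j \<in> F \<Longrightarrow> M k j = 0"
  shows "principal_minor M (insert k F) = M k k * principal_minor M F"
proof -
  have "principal_minor M (insert k F) =
    (\<Sum>p | p permutes F. of_int (sign p) * (\<Prod>i\<in>insert k F. M i (p i)))"
    unfolding principal_minor_def
  proof (rule sum.mono_neutral_right)
    show "finite {p. p permutes insert k F}" using assms(1) by (simp add: finite_permutations)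
    show "{p. p permutes F} \<subseteq> {p. p permutes insert k F}"
      by (auto intro: permutes_subset)
    show "\<forall>p\<in>{p. p permutes insert k F} - {p. p permutes F}.
        of_int (sign p) * (\<Prod>i\<in>insert k F. M i (p i)) = 0"
    proof
      fix p assume "p \<in> {p. p permutes insert k F} - {p. p permutes F}"
      then have p: "p permutes insert k F" and np: "\<not> p permutes F" by auto
      have "p k \<noteq> k" using permutes_superset[OF p, of F] np by auto
      moreover have "p k \<in> insert k F" using permutes_in_image[OF p, of k] by blast
      ultimately have "M k (p k) = 0" using assms(3) by auto
      then show "of_int (sign p) * (\<Prod>i\<in>insert k F. M i (p i)) = 0"
        using assms by simp
    qed
  qed
  also have "\<dots> = M k k * principal_minor M F"
    unfolding principal_minor_def sum_distrib_left
    by (intro sum.cong refl) (use assms in \<open>auto simp: permutes_not_in mult_ac\<close>)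
  finally show ?thesis .
qed

text \<open>Subtracting \<open>\<phi>\<^sub>k / \<phi>\<^sub>m\<close> times row \<open>m = Max F\<close> from row \<open>k\<close> annihilates every entry of row
  \<open>k\<close> except the diagonal one, because both rows are multiples of \<open>\<psi>\<^sub>j\<close> in the columns \<open>j \<le> m\<close>.
  The factor on the right is the new diagonal entry.\<close>

lemma principal_minor_insert_green:
  fixes \<phi> \<psi> :: "nat \<Rightarrow> complex"
  defines "G \<equiv> \<lambda>i j. \<phi> (max i j) * \<psi> (min i j)"
  assumes "finite F" "F \<noteq> {}" "Max F < k" "\<phi> (Max F) \<noteq> 0"
  shows "principal_minor G (insert k F) =
    principal_minor G F * (\<phi> k / \<phi> (Max F) * (\<psi> k * \<phi> (Max F) - \<psi> (Max F) * \<phi> k))"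
proof -
  define m where "m = Max F"
  define t where "t = - (\<phi> k / \<phi> m)"
  define G' where "G' = (\<lambda>i j. if i = k then G k j + t * G m j else G i j)"
  have mF: "m \<in> F" and le: "\<And>j. j \<in> F \<Longrightarrow> j \<le> m" and mk: "m < k"
    using assms by (auto simp: m_def)
  have kF: "k \<notin> F" using le mk by force
  have "principal_minor G (insert k F) = principal_minor G' (insert k F)"
    unfolding G'_def using mF mk assms(2) by (subst principal_minor_row_add) auto
  also have "\<dots> = G' k k * principal_minor G' F"
  proof (rule principal_minor_insert_corner[OF assms(2) kF])
    fix j assume "j \<in> F"
    then have "j \<le> m" "j \<le> k" using le mk by force+
    then show "G' k j = 0"
      using assms(5) by (simp add: G'_def G_def t_def m_def[symmetric] max_def min_def)
  qed
  also have "principal_minor G' F = principal_minor G F"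
    by (rule principal_minor_cong) (use kF in \<open>auto simp: G'_def\<close>)
  also have "G' k k = \<phi> k / \<phi> m * (\<psi> k * \<phi> m - \<psi> m * \<phi> k)"
    using mk assms(5) by (simp add: G'_def G_def t_def m_def[symmetric] max_def min_def field_simps)
  finally show ?thesis by (simp add: m_def)
qed

section \<open>Fredholm series as limits of finite sums\<close>

lemma sum_Pow_insert:
  assumes "finite A" "k \<notin> A"
  shows "(\<Sum>F\<in>Pow (insert k A). g F) = (\<Sum>F\<in>Pow A. g F) + (\<Sum>F\<in>Pow A. g (insert k F))"
proof -
  have "inj_on (insert k) (Pow A)" using assms(2) by (auto simp: inj_on_def)
  moreover have "Pow A \<inter> insert k ` Pow A = {}" using assms(2) by auto
  ultimately show ?thesis using assms(1)
    by (simp add: Pow_insert sum.union_disjoint sum.reindex)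
qed

text \<open>Nonempty subsets are sorted by their largest element \<open>j\<close>.\<close>

lemma sum_Pow_lessThan_Max:
  fixes k :: nat
  shows "(\<Sum>F\<in>Pow {..<k}. g F) = g {} + (\<Sum>j<k. \<Sum>F\<in>Pow {..<j}. g (insert j F))"
  by (induction k) (auto simp: lessThan_Suc sum_Pow_insert add_ac)

lemma sum_Pow_prod:
  fixes a :: "'i \<Rightarrow> 'a::comm_semiring_1"
  assumes "finite A"
  shows "(\<Sum>F\<in>Pow A. \<Prod>i\<in>F. a i) = (\<Prod>i\<in>A. 1 + a i)"
  using assms
proof (induction A)
  case (insert k A)
  have "(\<Sum>F\<in>Pow A. \<Prod>i\<in>insert k F. a i) = (\<Sum>F\<in>Pow A. a k * (\<Prod>i\<in>F. a i))"
    by (rule sum.cong[OF refl], subst prod.insert)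
       (use insert in \<open>auto dest: finite_subset\<close>)
  then show ?case using insert by (simp add: sum_Pow_insert sum_distrib_left[symmetric] ring_distribs)
qed simp

lemma prod_one_plus_le_exp:
  fixes a :: "'i \<Rightarrow> real"
  assumes "finite A" "\<And>i. i \<in> A \<Longrightarrow> a i \<ge> 0"
  shows "(\<Prod>i\<in>A. 1 + a i) \<le> exp (\<Sum>i\<in>A. a i)"
  unfolding exp_sum[OF assms(1)]
proof (rule prod_mono)
  fix i assume "i \<in> A"
  then show "0 \<le> 1 + a i \<and> 1 + a i \<le> exp (a i)"
    using assms(2)[of i] exp_ge_add_one_self[of "a i"] by simp
qed

text \<open>The bound makes the sum over all finite sets \<open>F\<close> absolutely convergent, since
  \<open>\<Sum>\<^bsub>F \<subseteq> {..<N}\<^esub> \<Prod>\<^bsub>i\<in>F\<^esub> a\<^sub>i = \<Prod>\<^bsub>i<N\<^esub> (1 + a\<^sub>i) \<le> exp (\<Sum>i. a\<^sub>i)\<close>. It may then be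
  summed both by cardinality, as in the Fredholm determinant, and along \<open>Pow {..<N}\<close>.\<close>

lemma tendsto_fredholm_series:
  fixes m :: "nat set \<Rightarrow> complex"
  assumes bound: "\<And>F. finite F \<Longrightarrow> norm (m F) \<le> (\<Prod>i\<in>F. a i)"
    and a: "\<And>i. a i \<ge> 0" "summable a"
  shows "(\<lambda>N. \<Sum>F\<in>Pow {..<N}. (- 1) ^ card F * m F) \<longlonglongrightarrow>
    (\<Sum>k. (- 1) ^ k * (\<Sum>\<^sub>\<infinity>F\<in>{F. finite F \<and> card F = k}. m F))"
proof -
  define g where "g F = (- 1) ^ card F * m F" for F
  define L where "L k = {F :: nat set. finite F \<and> card F = k}" for k
  have normg: "norm (g F) \<le> (\<Prod>i\<in>F. a i)" if "finite F" for F
    using bound[OF that] by (simp add: g_def norm_mult norm_power)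
  have "(\<lambda>F. norm (g F)) summable_on Collect finite"
  proof (rule nonneg_bdd_above_summable_on)
    show "bdd_above (sum (\<lambda>F. norm (g F)) ` {X. X \<subseteq> Collect finite \<and> finite X})"
    proof (rule bdd_aboveI2)
      fix X :: "nat set set" assume "X \<in> {X. X \<subseteq> Collect finite \<and> finite X}"
      then have X: "X \<subseteq> Collect finite" "finite X" by auto
      then have "finite (\<Union>X)" by auto
      then obtain N where "\<Union>X \<subseteq> {..<N}" using finite_nat_iff_bounded by blast
      then have XN: "X \<subseteq> Pow {..<N}" by auto
      have "(\<Sum>F\<in>X. norm (g F)) \<le> (\<Sum>F\<in>X. \<Prod>i\<in>F. a i)"
        using X by (intro sum_mono normg) auto
      also have "\<dots> \<le> (\<Sum>F\<in>Pow {..<N}. \<Prod>i\<in>F. a i)"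
        using XN a by (intro sum_mono2) (auto intro: prod_nonneg)
      also have "\<dots> = (\<Prod>i<N. 1 + a i)" by (rule sum_Pow_prod) simp
      also have "\<dots> \<le> exp (\<Sum>i<N. a i)" using a by (intro prod_one_plus_le_exp) auto
      also have "\<dots> \<le> exp (suminf a)" using a by (simp add: sum_le_suminf)
      finally show "(\<Sum>F\<in>X. norm (g F)) \<le> exp (suminf a)" .
    qed
  qed auto
  then have sumg: "g summable_on Collect finite" by (rule abs_summable_summable)
  then have "(sum g \<longlongrightarrow> infsum g (Collect finite)) (finite_subsets_at_top (Collect finite))"
    using has_sum_infsum has_sum_def by blast
  moreover have "filterlim (\<lambda>N. Pow {..<N}) (finite_subsets_at_top (Collect finite)) sequentially"
    unfolding filterlim_finite_subsets_at_top
  proof (intro allI impI)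
    fix X :: "nat set set" assume X: "finite X \<and> X \<subseteq> Collect finite"
    then have "finite (\<Union>X)" by auto
    then obtain N where N: "\<Union>X \<subseteq> {..<N}" using finite_nat_iff_bounded by blast
    show "\<forall>\<^sub>F n in sequentially. finite (Pow {..<n}) \<and> X \<subseteq> Pow {..<n} \<and> Pow {..<n} \<subseteq> Collect (finite :: nat set \<Rightarrow> bool)"
      using eventually_ge_at_top[of N]
    proof eventually_elim
      case (elim n)
      have "X \<subseteq> Pow {..<N}" using N by blast
      also have "\<dots> \<subseteq> Pow {..<n}" using elim by (intro Pow_mono) auto
      finally show ?case by (auto intro: finite_subset[OF _ finite_lessThan])
    qed
  qed
  ultimately have lim: "(\<lambda>N. \<Sum>F\<in>Pow {..<N}. g F) \<longlonglongrightarrow> infsum g (Collect finite)"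
    using filterlim_compose by blast
  (* regroup by cardinality *)
  have bij: "bij_betw snd (Sigma UNIV L) (Collect finite)"
    by (rule bij_betw_byWitness[where f' = "\<lambda>F. (card F, F)"]) (auto simp: L_def)
  have sumS: "(\<lambda>(k, F). g F) summable_on (Sigma UNIV L)"
    using sumg summable_on_reindex_bij_betw[OF bij, of g] by (simp add: case_prod_unfold)
  have "infsum g (Collect finite) = infsum (\<lambda>(k, F). g F) (Sigma UNIV L)"
    using infsum_reindex_bij_betw[OF bij, of g] by (simp add: case_prod_unfold)
  also have "\<dots> = (\<Sum>\<^sub>\<infinity>k. infsum g (L k))"
    using infsum_Sigma'_banach[OF sumS] by simp
  also have "\<dots> = (\<Sum>k. infsum g (L k))"
    using has_sum_imp_sums[OF has_sum_infsum[OF summable_on_Sigma_banach[OF sumS]]]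
    by (simp add: sums_iff)
  also have "(\<lambda>k. infsum g (L k)) = (\<lambda>k. (- 1) ^ k * infsum m (L k))"
  proof
    fix k
    have "infsum g (L k) = infsum (\<lambda>F. (- 1) ^ k * m F) (L k)"
      by (rule infsum_cong) (auto simp: g_def L_def)
    then show "infsum g (L k) = (- 1) ^ k * infsum m (L k)"
      by (simp add: infsum_cmult_right')
  qed
  finally have "infsum g (Collect finite) = (\<Sum>k. (- 1) ^ k * infsum m (L k))" .
  then show ?thesis using lim by (simp only: g_def L_def)
qed

section \<open>Minors of the free Green kernel\<close>

text \<open>The regular solution with potential \<open>v\<close>. All sequences that solve (E) are shifted by one so
  as to live on the natural numbers: position \<open>n\<close> holds the entry with index \<open>n - 1\<close>.\<close>

fun reg :: "complex \<Rightarrow> (nat \<Rightarrow> complex) \<Rightarrow> nat \<Rightarrow> complex" where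
  "reg l v 0 = 0"
| "reg l v (Suc 0) = 1"
| "reg l v (Suc (Suc n)) = reg l v n + (v n - l) * reg l v (Suc n)"

text \<open>The root \<open>\<mu>\<close> of \<open>\<mu>\<^sup>2 + \<lambda>\<mu> - 1 = 0\<close> inside the unit disc; the other root is
  \<open>\<nu> = - 1 / \<mu>\<close>.\<close>

locale char_root =
  fixes \<mu> l :: complex
  assumes mu_nz: "\<mu> \<noteq> 0" and mu_less_1: "norm \<mu> < 1" and l_eq: "l = 1 / \<mu> - \<mu>"
begin

definition \<nu> :: complex where "\<nu> = - (1 / \<mu>)"

text \<open>The regular solution of the free equation, in closed form and shifted like \<open>reg\<close>.\<close>

definition h :: "nat \<Rightarrow> complex" where
  "h n = (\<mu> ^ n - \<nu> ^ n) / (\<mu> - \<nu>)"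

text \<open>The numerator of \<open>\<mu>\<^sup>n h n\<close> has modulus at most \<open>2\<close>, because \<open>\<mu>\<^sup>n \<nu>\<^sup>n = (-1)\<^sup>n\<close>; the same numerator
  appears when one row of the Green kernel is eliminated.\<close>

definition C :: real where "C = 2 / norm (\<mu> - \<nu>)"

text \<open>The inverse of \<open>S - S\<^sup>-\<^sup>1 - \<lambda>\<close> has the kernel \<open>- (-1)\<^sup>j green i j\<close>: the decaying free solution at
  the larger index times the regular one at the smaller index.\<close>

definition green :: "nat \<Rightarrow> nat \<Rightarrow> complex" where
  "green i j = \<mu> ^ Suc (max i j) * h (Suc (min i j))"

text \<open>The principal minors of \<open>K\<^sub>\<lambda>\<^sup>+\<close>, with \<open>v\<^sub>n = b\<^sub>n c\<^sub>n\<close>.\<close>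

definition minor :: "(nat \<Rightarrow> complex) \<Rightarrow> nat set \<Rightarrow> complex" where
  "minor v F = (\<Prod>i\<in>F. v i * (- 1) ^ i) * principal_minor green F"

text \<open>This is \<open>\<mu>\<close> times the Wronskian at \<open>n\<close> of \<open>\<mu>\<^sup>n\<close> and the regular solution. If \<open>v\<close> vanishes from
  index \<open>n\<close> on, then \<open>\<mu>\<^sup>n\<close> coincides with the Jost solution there, and this value is the Jost
  function.\<close>

definition jost_trunc :: "(nat \<Rightarrow> complex) \<Rightarrow> nat \<Rightarrow> complex" where
  "jost_trunc v n = (- 1) ^ n * (\<mu> ^ n * reg l v (Suc n) - \<mu> ^ Suc n * reg l v n)"

lemma mu_nu: "\<mu> * \<nu> = - 1" and mu_square: "\<mu> * \<mu> = 1 - l * \<mu>" and nu_square: "\<nu> * \<nu> = 1 - l * \<nu>"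
  using mu_nz by (simp_all add: \<nu>_def l_eq field_simps)

lemma mu_nu_power: "\<mu> ^ n * \<nu> ^ n = (- 1) ^ n"
  by (simp add: mu_nu flip: power_mult_distrib)

lemma mu_neq_nu: "\<mu> - \<nu> \<noteq> 0"
proof
  assume "\<mu> - \<nu> = 0"
  then have "norm \<mu> * norm \<mu> = 1" using mu_nu by (metis eq_iff_diff_eq_0 norm_minus_cancel norm_mult norm_one)
  moreover have "norm \<mu> * norm \<mu> < 1 * 1" using mu_less_1 by (intro mult_strict_mono') auto
  ultimately show False by simp
qed

lemma C_pos: "C > 0" using mu_neq_nu by (simp add: C_def)

lemma h_0 [simp]: "h 0 = 0" by (simp add: h_def)
lemma h_1 [simp]: "h (Suc 0) = 1" using mu_neq_nu by (simp add: h_def)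

lemma mu_power_rec: "\<mu> ^ Suc (Suc n) = \<mu> ^ n - l * \<mu> ^ Suc n"
proof -
  have "\<mu> ^ Suc (Suc n) = \<mu> * \<mu> * \<mu> ^ n" by simp
  then show ?thesis unfolding mu_square by (simp add: algebra_simps)
qed

lemma h_rec: "h (Suc (Suc n)) = h n - l * h (Suc n)"
proof -
  have "\<nu> ^ Suc (Suc n) = \<nu> * \<nu> * \<nu> ^ n" by simp
  then have "\<nu> ^ Suc (Suc n) = \<nu> ^ n - l * \<nu> ^ Suc n"
    unfolding nu_square by (simp add: algebra_simps)
  then have "\<mu> ^ Suc (Suc n) - \<nu> ^ Suc (Suc n) = (\<mu> ^ n - \<nu> ^ n) - l * (\<mu> ^ Suc n - \<nu> ^ Suc n)"
    unfolding mu_power_rec by (simp add: algebra_simps)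
  moreover have "(a - l * b) / (\<mu> - \<nu>) = a / (\<mu> - \<nu>) - l * (b / (\<mu> - \<nu>))" for a b
    by (simp add: diff_divide_distrib)
  ultimately show ?thesis unfolding h_def by simp
qed

text \<open>The Casorati determinant of two free solutions changes its sign at each step; this one starts
  with \<open>1\<close>.\<close>

lemma h_casorati: "h (Suc n) * \<mu> ^ n - \<mu> ^ Suc n * h n = (- 1) ^ n"
proof (induction n)
  case (Suc n)
  have "h (Suc (Suc n)) * \<mu> ^ Suc n - \<mu> ^ Suc (Suc n) * h (Suc n) = - (h (Suc n) * \<mu> ^ n - \<mu> ^ Suc n * h n)"
    unfolding h_rec mu_power_rec by (simp add: algebra_simps)
  then show ?case unfolding Suc by simp
qed simp

lemma norm_mu_power_diff: "norm (\<mu> ^ n * (\<mu> ^ n - \<nu> ^ n)) \<le> 2"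
proof -
  have "norm (\<mu> ^ n * (\<mu> ^ n - \<nu> ^ n)) = norm (\<mu> ^ n * \<mu> ^ n - (- 1) ^ n)"
    by (simp add: right_diff_distrib mu_nu_power)
  also have "\<dots> \<le> norm \<mu> ^ n * norm \<mu> ^ n + 1"
    by (rule order.trans[OF norm_triangle_ineq4]) (simp add: norm_mult norm_power)
  also have "\<dots> \<le> 1 * 1 + 1" using mu_less_1
    by (intro add_mono mult_mono power_le_one) auto
  finally show ?thesis by simp
qed

lemma norm_h_le: "norm (h n) * norm \<mu> ^ n \<le> C"
proof -
  have "norm (h n) * norm \<mu> ^ n = norm (\<mu> ^ n * (\<mu> ^ n - \<nu> ^ n)) / norm (\<mu> - \<nu>)"
    by (simp add: h_def norm_divide norm_mult norm_power)
  then show ?thesis using norm_mu_power_diff[of n] by (simp add: C_def divide_right_mono)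
qed

text \<open>The Wronskian-like factor grows like \<open>\<bar>\<mu>\<bar>\<^bsup>m-k\<^esup>\<close>, which the quotient in front compensates. A
  minor therefore picks up only the constant \<open>C\<close> for each index.\<close>

lemma green_step_bound:
  assumes "m < k"
  shows "norm (\<mu> ^ Suc k / \<mu> ^ Suc m * (h (Suc k) * \<mu> ^ Suc m - h (Suc m) * \<mu> ^ Suc k)) \<le> C"
proof -
  obtain e where k: "k = m + e" using assms less_imp_add_positive by metis
  have "h (Suc k) * \<mu> ^ Suc m - h (Suc m) * \<mu> ^ Suc k =
      \<mu> ^ Suc m * \<nu> ^ Suc m * (\<mu> ^ e - \<nu> ^ e) / (\<mu> - \<nu>)"
    unfolding h_def k times_divide_eq_left diff_divide_distrib[symmetric]
    by (intro arg_cong2[where f = "(/)"] refl) (simp add: algebra_simps power_add)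
  moreover have "\<mu> ^ Suc k / \<mu> ^ Suc m = \<mu> ^ e"
    using mu_nz by (simp add: k power_add)
  ultimately have "norm (\<mu> ^ Suc k / \<mu> ^ Suc m * (h (Suc k) * \<mu> ^ Suc m - h (Suc m) * \<mu> ^ Suc k))
    = norm (\<mu> ^ e * (\<mu> ^ e - \<nu> ^ e)) / norm (\<mu> - \<nu>)"
    unfolding mu_nu_power by (simp add: norm_divide norm_mult norm_power)
  then show ?thesis using norm_mu_power_diff[of e] by (simp add: C_def divide_right_mono)
qed

lemma minor_empty [simp]: "minor v {} = 1" by (simp add: minor_def)

lemma minor_singleton: "minor v {k} = v k * (- 1) ^ k * (\<mu> ^ Suc k * h (Suc k))"
  using principal_minor_insert_corner[of "{}" k green] by (simp add: minor_def green_def)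

lemma minor_insert:
  assumes "finite F" "F \<noteq> {}" "Max F < k"
  shows "minor v (insert k F) = minor v F * (v k * (- 1) ^ k) *
    (\<mu> ^ Suc k / \<mu> ^ Suc (Max F) *
      (h (Suc k) * \<mu> ^ Suc (Max F) - h (Suc (Max F)) * \<mu> ^ Suc k))"
proof -
  have "k \<notin> F" using assms by (meson Max_ge leD)
  then show ?thesis
    using principal_minor_insert_green[of F k "\<lambda>n. \<mu> ^ Suc n" "\<lambda>n. h (Suc n)"] assms mu_nz
    unfolding minor_def green_def by simp
qed

text \<open>By induction over the largest element, with one factor \<open>C \<bar>v\<^sub>k\<bar>\<close> for each step.\<close>

lemma norm_minor_le:
  assumes "finite F"
  shows "norm (minor v F) \<le> (\<Prod>i\<in>F. C * norm (v i))"
  using assms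
proof (induction F rule: finite_linorder_max_induct)
  case (insert k F)
  have kF: "k \<notin> F" using insert.hyps(2) by blast
  show ?case
  proof (cases "F = {}")
    case True
    have "norm (minor v {k}) = norm (v k) * (norm (h (Suc k)) * norm \<mu> ^ Suc k)"
      by (simp add: minor_singleton norm_mult norm_power)
    also have "\<dots> \<le> norm (v k) * C" by (intro mult_left_mono norm_h_le) auto
    finally show ?thesis using True by (simp add: mult.commute)
  next
    case False
    have "Max F < k" using insert.hyps False by simp
    then have "norm (minor v (insert k F)) = norm (minor v F) * norm (v k) *
       norm (\<mu> ^ Suc k / \<mu> ^ Suc (Max F) *
      (h (Suc k) * \<mu> ^ Suc (Max F) - h (Suc (Max F)) * \<mu> ^ Suc k))"
      using minor_insert[OF insert.hyps(1) False] by (simp add: norm_mult norm_power)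
    also have "\<dots> \<le> (\<Prod>i\<in>F. C * norm (v i)) * norm (v k) * C"
      by (intro mult_mono insert.IH green_step_bound \<open>Max F < k\<close>)
         (use C_pos in \<open>auto intro!: prod_nonneg mult_nonneg_nonneg\<close>)
    finally show ?thesis using kF insert.hyps(1) by (simp add: mult_ac)
  qed
qed simp

text \<open>This sum and the next one telescope: by the recurrence, the increment of the Wronskian of a free solution
  with \<open>reg\<close> is that free solution times \<open>v\<^sub>n\<close> times \<open>reg\<close>.\<close>

lemma sum_phi_reg: "1 + (\<Sum>j<n. \<mu> ^ Suc j * (- ((- 1) ^ j * v j * reg l v (Suc j)))) = jost_trunc v n"
proof (induction n)
  case (Suc n)
  have "jost_trunc v (Suc n) - jost_trunc v n = \<mu> ^ Suc n * (- ((- 1) ^ n * v n * reg l v (Suc n)))"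
    using mu_nz unfolding jost_trunc_def by (simp add: l_eq field_simps)
  then show ?case using Suc by (simp add: algebra_simps)
qed (simp add: jost_trunc_def)

lemma sum_psi_reg: "(\<Sum>j<n. h (Suc j) * (- ((- 1) ^ j * v j * reg l v (Suc j)))) =
    (- 1) ^ n * (h n * reg l v (Suc n) - h (Suc n) * reg l v n)"
  by (induction n) (simp_all add: h_rec algebra_simps)

text \<open>Variation of constants. The sum splits into \<open>h\<close> and \<open>\<mu>\<^sup>n\<close> with the two Wronskians as
  coefficients, from which \<open>reg\<close> is recovered by Cramer's rule.\<close>

lemma reg_volterra:
  "reg l v (Suc k) = h (Suc k) +
    (\<Sum>j<k. (h (Suc k) * \<mu> ^ Suc j - h (Suc j) * \<mu> ^ Suc k) * (- ((- 1) ^ j * v j * reg l v (Suc j))))"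
    (is "_ = _ + ?S")
proof -
  let ?a = "\<lambda>j. - ((- 1) ^ j * v j * reg l v (Suc j))"
  have "h (Suc k) + ?S = h (Suc k) * (1 + (\<Sum>j<k. \<mu> ^ Suc j * ?a j)) - \<mu> ^ Suc k * (\<Sum>j<k. h (Suc j) * ?a j)"
    by (simp add: sum_distrib_left left_diff_distrib sum_subtractf ring_distribs mult_ac sum_negf)
  also have "\<dots> = (- 1) ^ k * reg l v (Suc k) * (h (Suc k) * \<mu> ^ k - \<mu> ^ Suc k * h k)"
    unfolding sum_phi_reg sum_psi_reg jost_trunc_def by (simp add: algebra_simps)
  also have "\<dots> = reg l v (Suc k)"
    unfolding h_casorati by (simp add: mult_ac flip: power_mult_distrib)
  finally show ?thesis by simp
qed

text \<open>The sets with largest element \<open>k\<close> contribute exactly the \<open>k\<close>-th term of \<open>sum_phi_reg\<close>. Removing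
  \<open>k\<close> and sorting by the next largest element \<open>j\<close> produces, through \<open>minor_insert\<close>, the Volterra
  equation for \<open>reg\<close>.\<close>

lemma sum_minor_max:
  "(\<Sum>F\<in>Pow {..<k}. (- 1) ^ card (insert k F) * minor v (insert k F)) =
   \<mu> ^ Suc k * (- ((- 1) ^ k * v k * reg l v (Suc k)))"
proof (induction k rule: less_induct)
  case (less k)
  let ?a = "\<lambda>j. - ((- 1) ^ j * v j * reg l v (Suc j))"
  let ?w = "\<lambda>j. \<mu> ^ Suc k / \<mu> ^ Suc j * (h (Suc k) * \<mu> ^ Suc j - h (Suc j) * \<mu> ^ Suc k)"
  have *: "(\<Sum>F\<in>Pow {..<j}. (- 1) ^ card (insert k (insert j F)) * minor v (insert k (insert j F))) =
      - (v k * (- 1) ^ k) * ?w j * (\<mu> ^ Suc j * ?a j)" if "j < k" for j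
  proof -
    have "(- 1) ^ card (insert k (insert j F)) * minor v (insert k (insert j F)) =
      - (v k * (- 1) ^ k) * ?w j * ((- 1) ^ card (insert j F) * minor v (insert j F))" if F: "F \<in> Pow {..<j}" for F
    proof -
      have fin: "finite F" using F finite_subset by auto
      have mx: "Max (insert j F) = j" using F fin by (intro Max_eqI) auto
      have "k \<notin> insert j F" using F \<open>j < k\<close> by auto
      then show ?thesis
        using minor_insert[of "insert j F" k v] fin \<open>j < k\<close> unfolding mx by simp
    qed
    then have "(\<Sum>F\<in>Pow {..<j}. (- 1) ^ card (insert k (insert j F)) * minor v (insert k (insert j F))) =
      - (v k * (- 1) ^ k) * ?w j * (\<Sum>F\<in>Pow {..<j}. (- 1) ^ card (insert j F) * minor v (insert j F))"
      unfolding sum_distrib_left by (intro sum.cong) auto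
    then show ?thesis unfolding less.IH[OF that] .
  qed
  have "(\<Sum>F\<in>Pow {..<k}. (- 1) ^ card (insert k F) * minor v (insert k F)) =
      - (v k * (- 1) ^ k) * (\<mu> ^ Suc k * h (Suc k)) +
      (\<Sum>j<k. - (v k * (- 1) ^ k) * ?w j * (\<mu> ^ Suc j * ?a j))"
    unfolding sum_Pow_lessThan_Max[where k = k]
    using * by (simp add: minor_singleton)
  also have "(\<Sum>j<k. - (v k * (- 1) ^ k) * ?w j * (\<mu> ^ Suc j * ?a j)) =
     - (v k * (- 1) ^ k) * \<mu> ^ Suc k * (\<Sum>j<k. (h (Suc k) * \<mu> ^ Suc j - h (Suc j) * \<mu> ^ Suc k) * ?a j)"
    unfolding sum_distrib_left using mu_nz by (intro sum.cong) (auto simp: field_simps)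
  also have "- (v k * (- 1) ^ k) * (\<mu> ^ Suc k * h (Suc k)) + - (v k * (- 1) ^ k) * \<mu> ^ Suc k * T =
      \<mu> ^ Suc k * (- ((- 1) ^ k * v k * (h (Suc k) + T)))" for T
    by (simp add: algebra_simps)
  finally show ?case unfolding reg_volterra[symmetric] .
qed

theorem sum_minor_eq_jost_trunc:
  "(\<Sum>F\<in>Pow {..<n}. (- 1) ^ card F * minor v F) = jost_trunc v n"
proof -
  have "(\<Sum>F\<in>Pow {..<n}. (- 1) ^ card F * minor v F) = 1 + (\<Sum>j<n. \<mu> ^ Suc j * (- ((- 1) ^ j * v j * reg l v (Suc j))))"
    unfolding sum_Pow_lessThan_Max[where k = n] sum_minor_max by simp
  then show ?thesis unfolding sum_phi_reg .
qed

end

section \<open>The Jost solution of the three-term recurrence\<close>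

text \<open>The continuant identity: the recurrence is peeled off at the first coefficient instead of at
  the last.\<close>

lemma reg_shift:
  "reg l v (Suc (Suc n)) = (v 0 - l) * reg l (\<lambda>k. v (Suc k)) (Suc n) + reg l (\<lambda>k. v (Suc (Suc k))) n"
proof (induction n rule: induct_nat_012)
  case (ge2 n)
  show ?case
    by (subst reg.simps(3), subst ge2(2), subst ge2(1)) (simp add: algebra_simps)
qed simp_all

context char_root
begin

lemma jost_trunc_0 [simp]: "jost_trunc v 0 = 1"
  by (simp add: jost_trunc_def)

lemma jost_trunc_shift:
  "jost_trunc v (Suc (Suc n)) = \<mu>\<^sup>2 * jost_trunc (\<lambda>k. v (Suc (Suc k))) n
     - \<mu> * (v 0 - l) * jost_trunc (\<lambda>k. v (Suc k)) (Suc n)"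
  unfolding jost_trunc_def reg_shift[of l v n] reg_shift[of l v "Suc n"]
  by (simp add: algebra_simps power2_eq_square)

text \<open>The difference consists of the minors over the sets that are contained in \<open>{..<n}\<close> but not in
  \<open>{..<m}\<close>.\<close>

lemma jost_trunc_diff_bound:
  assumes "m \<le> n"
  shows "norm (jost_trunc v n - jost_trunc v m) \<le>
    exp (C * (\<Sum>i<m. norm (v i))) * (exp (C * (\<Sum>i=m..<n. norm (v i))) - 1)"
proof -
  let ?a = "\<lambda>i. C * norm (v i)"
  have a: "?a i \<ge> 0" for i using C_pos by simp
  have sub: "Pow {..<m} \<subseteq> Pow {..<n}" using assms by auto
  have "jost_trunc v n - jost_trunc v m = (\<Sum>F\<in>Pow {..<n} - Pow {..<m}. (- 1) ^ card F * minor v F)"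
    unfolding sum_minor_eq_jost_trunc[symmetric] using sub by (subst sum_diff) auto
  also have "norm \<dots> \<le> (\<Sum>F\<in>Pow {..<n} - Pow {..<m}. \<Prod>i\<in>F. ?a i)"
  proof (rule order.trans[OF norm_sum sum_mono])
    fix F assume "F \<in> Pow {..<n} - Pow {..<m}"
    then have "finite F" using finite_subset by auto
    then show "norm ((- 1) ^ card F * minor v F) \<le> (\<Prod>i\<in>F. ?a i)"
      using norm_minor_le by (simp add: norm_mult norm_power)
  qed
  also have "\<dots> = (\<Prod>i<n. 1 + ?a i) - (\<Prod>i<m. 1 + ?a i)"
    using sub by (subst sum_diff) (auto simp: sum_Pow_prod)
  also have "(\<Prod>i<n. 1 + ?a i) = (\<Prod>i<m. 1 + ?a i) * (\<Prod>i=m..<n. 1 + ?a i)"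
  proof -
    have "{..<n} = {..<m} \<union> {m..<n}" using assms by auto
    then show ?thesis by (metis (no_types, lifting) finite_lessThan finite_atLeastLessThan
      ivl_disj_int_one(2) prod.union_disjoint)
  qed
  also have "\<dots> - (\<Prod>i<m. 1 + ?a i) = (\<Prod>i<m. 1 + ?a i) * ((\<Prod>i=m..<n. 1 + ?a i) - 1)"
    by (simp add: algebra_simps)
  also have "\<dots> \<le> exp (\<Sum>i<m. ?a i) * (exp (\<Sum>i=m..<n. ?a i) - 1)"
  proof (intro mult_mono diff_mono order.refl prod_one_plus_le_exp)
    show "0 \<le> (\<Prod>i=m..<n. 1 + ?a i) - 1" using prod_ge_1[of "{m..<n}" "\<lambda>i. 1 + ?a i"] a by simp
  qed (use a in auto)
  finally show ?thesis by (simp add: sum_distrib_left)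
qed

text \<open>The common value of the four functions, as a functional of the potential.\<close>

definition jost_fun :: "(nat \<Rightarrow> complex) \<Rightarrow> complex" where
  "jost_fun v = lim (jost_trunc v)"

context
  fixes v :: "nat \<Rightarrow> complex"
  assumes sv: "summable (\<lambda>n. norm (v n))"
begin

lemma jost_trunc_fredholm:
  "jost_trunc v \<longlonglongrightarrow> (\<Sum>k. (- 1) ^ k * (\<Sum>\<^sub>\<infinity>F\<in>{F. finite F \<and> card F = k}. minor v F))"
  using tendsto_fredholm_series[of "minor v" "\<lambda>i. C * norm (v i)"] C_pos sv norm_minor_le[of _ v]
  unfolding sum_minor_eq_jost_trunc by (simp add: summable_mult)

lemma jost_trunc_tendsto: "jost_trunc v \<longlonglongrightarrow> jost_fun v"
  using jost_trunc_fredholm convergent_LIMSEQ_iff convergentI unfolding jost_fun_def by blast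

lemma jost_fun_fredholm:
  "jost_fun v = (\<Sum>k. (- 1) ^ k * (\<Sum>\<^sub>\<infinity>F\<in>{F. finite F \<and> card F = k}. minor v F))"
  using LIMSEQ_unique[OF jost_trunc_tendsto jost_trunc_fredholm] .

lemma jost_fun_diff_bound:
  "norm (jost_fun v - jost_trunc v m) \<le>
    exp (C * (\<Sum>i. norm (v i))) * (exp (C * (\<Sum>i. norm (v (i + m)))) - 1)"
proof (rule LIMSEQ_le_const2)
  show "(\<lambda>n. norm (jost_trunc v n - jost_trunc v m)) \<longlonglongrightarrow> norm (jost_fun v - jost_trunc v m)"
    by (intro tendsto_intros jost_trunc_tendsto)
  show "\<exists>N. \<forall>n\<ge>N. norm (jost_trunc v n - jost_trunc v m) \<le>
    exp (C * (\<Sum>i. norm (v i))) * (exp (C * (\<Sum>i. norm (v (i + m)))) - 1)"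
  proof (intro exI allI impI)
    fix n assume "m \<le> n"
    have "(\<Sum>i=m..<n. norm (v i)) = (\<Sum>i<n-m. norm (v (i + m)))"
      using \<open>m \<le> n\<close> by (intro sum.reindex_bij_witness[of _ "\<lambda>i. i + m" "\<lambda>i. i - m"]) auto
    also have "\<dots> \<le> (\<Sum>i. norm (v (i + m)))"
      using summable_iff_shift[of "\<lambda>i. norm (v i)" m] sv by (intro sum_le_suminf) auto
    finally have 1: "(\<Sum>i=m..<n. norm (v i)) \<le> (\<Sum>i. norm (v (i + m)))" .
    have 2: "(\<Sum>i<m. norm (v i)) \<le> (\<Sum>i. norm (v i))"
      using sv by (intro sum_le_suminf) auto
    have "norm (jost_trunc v n - jost_trunc v m) \<le>
       exp (C * (\<Sum>i<m. norm (v i))) * (exp (C * (\<Sum>i=m..<n. norm (v i))) - 1)"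
      using \<open>m \<le> n\<close> by (rule jost_trunc_diff_bound)
    also have "\<dots> \<le> exp (C * (\<Sum>i. norm (v i))) * (exp (C * (\<Sum>i. norm (v (i + m)))) - 1)"
      using 1 2 C_pos by (intro mult_mono) (auto intro!: mult_left_mono sum_nonneg mult_nonneg_nonneg)
    finally show "norm (jost_trunc v n - jost_trunc v m) \<le> exp (C * (\<Sum>i. norm (v i))) * (exp (C * (\<Sum>i. norm (v (i + m)))) - 1)" .
  qed
qed

end

lemma summable_shift:
  assumes "summable (\<lambda>n. norm (v n))"
  shows "summable (\<lambda>n. norm (v (n + m)))"
  using assms by (simp add: summable_iff_shift[of "\<lambda>n. norm (v n)"])

text \<open>The Jost solution, shifted by one like \<open>reg\<close>: \<open>z\<^sup>+\<^sub>n\<^sub>-\<^sub>1 = \<mu>\<^bsup>n-1\<^esup> jost_fun (S\<^sup>-\<^sup>n v)\<close>.\<close>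

definition jost_seq :: "(nat \<Rightarrow> complex) \<Rightarrow> nat \<Rightarrow> complex" where
  "jost_seq v n = \<mu> ^ n / \<mu> * jost_fun (\<lambda>k. v (k + n))"

text \<open>Equation (E) for a sequence shifted like \<open>reg\<close>.\<close>

definition three_term :: "(nat \<Rightarrow> complex) \<Rightarrow> (nat \<Rightarrow> complex) \<Rightarrow> bool" where
  "three_term v s \<longleftrightarrow> (\<forall>n. s (Suc (Suc n)) = s n + (v n - l) * s (Suc n))"

lemma three_termD: "three_term v s \<Longrightarrow> s (Suc (Suc n)) = s n + (v n - l) * s (Suc n)"
  by (simp add: three_term_def)

lemma three_term_reg: "three_term v (reg l v)"
  by (simp add: three_term_def)

lemma three_term_scale: "three_term v s \<Longrightarrow> three_term v (\<lambda>n. a * s n)"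
  by (simp add: three_term_def distrib_left mult.left_commute)

lemma three_term_diff: "three_term v s \<Longrightarrow> three_term v t \<Longrightarrow> three_term v (\<lambda>n. s n - t n)"
  by (simp add: three_term_def right_diff_distrib)

text \<open>The limit of \<open>jost_trunc_shift\<close>, applied to the tail of \<open>v\<close> that starts at \<open>n\<close>.\<close>

lemma three_term_jost:
  assumes "summable (\<lambda>n. norm (v n))"
  shows "three_term v (jost_seq v)"
  unfolding three_term_def
proof
  fix n
  let ?J = "\<lambda>m. jost_fun (\<lambda>k. v (k + m))"
  have lim: "jost_trunc (\<lambda>k. v (k + m)) \<longlonglongrightarrow> ?J m" for m
    using assms by (intro jost_trunc_tendsto summable_shift)
  have "(\<lambda>i. jost_trunc (\<lambda>k. v (k + n)) (Suc (Suc i))) \<longlonglongrightarrow> ?J n"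
    using lim[of n] by (intro filterlim_compose[OF lim] filterlim_compose[OF filterlim_Suc filterlim_Suc])
  moreover have "(\<lambda>i. \<mu>\<^sup>2 * jost_trunc (\<lambda>k. v (k + Suc (Suc n))) i
     - \<mu> * (v n - l) * jost_trunc (\<lambda>k. v (k + Suc n)) (Suc i)) \<longlonglongrightarrow> \<mu>\<^sup>2 * ?J (Suc (Suc n)) - \<mu> * (v n - l) * ?J (Suc n)"
    by (intro tendsto_intros lim filterlim_compose[OF lim filterlim_Suc])
  ultimately have "?J n = \<mu>\<^sup>2 * ?J (Suc (Suc n)) - \<mu> * (v n - l) * ?J (Suc n)"
    by (intro LIMSEQ_unique) (simp_all add: jost_trunc_shift)
  then have "\<mu> ^ n / \<mu> * ?J n = \<mu> ^ n / \<mu> * (\<mu>\<^sup>2 * ?J (Suc (Suc n)) - \<mu> * (v n - l) * ?J (Suc n))"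
    by simp
  then show "jost_seq v (Suc (Suc n)) = jost_seq v n + (v n - l) * jost_seq v (Suc n)"
    unfolding jost_seq_def using mu_nz by (simp add: power2_eq_square algebra_simps)
qed

lemma jost_fun_tail_tendsto:
  assumes "summable (\<lambda>n. norm (v n))"
  shows "(\<lambda>n. jost_fun (\<lambda>k. v (k + n))) \<longlonglongrightarrow> 1"
proof -
  let ?t = "\<lambda>n. \<Sum>i. norm (v (i + n))"
  have t: "?t \<longlonglongrightarrow> 0" using suminf_exist_split2[OF assms] by simp
  have "(\<lambda>n. exp (C * ?t n) * (exp (C * ?t n) - 1)) \<longlonglongrightarrow> exp (C * 0) * (exp (C * 0) - 1)"
    by (intro tendsto_intros t)
  then have "(\<lambda>n. jost_fun (\<lambda>k. v (k + n)) - 1) \<longlonglongrightarrow> 0"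
  proof (rule Lim_null_comparison[rotated, OF tendsto_eq_rhs], simp, intro always_eventually allI)
    fix n
    show "norm (jost_fun (\<lambda>k. v (k + n)) - 1) \<le> exp (C * ?t n) * (exp (C * ?t n) - 1)"
      using jost_fun_diff_bound[OF summable_shift[OF assms, of n], of 0] by simp
  qed
  then show ?thesis by (simp add: LIM_zero_iff)
qed

lemma jost_seq_asymp:
  assumes "summable (\<lambda>n. norm (v n))"
  shows "(\<lambda>n. jost_seq v n * \<mu> / \<mu> ^ n) \<longlonglongrightarrow> 1"
  using jost_fun_tail_tendsto[OF assms] mu_nz by (simp add: jost_seq_def)

lemma three_term_casorati:
  assumes "three_term v s" "three_term v t"
  shows "(- 1) ^ n * (s n * t (Suc n) - s (Suc n) * t n) = s 0 * t (Suc 0) - s (Suc 0) * t 0"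
proof (induction n)
  case (Suc n)
  have "s (Suc n) * t (Suc (Suc n)) - s (Suc (Suc n)) * t (Suc n) = - (s n * t (Suc n) - s (Suc n) * t n)"
    unfolding three_termD[OF assms(1)] three_termD[OF assms(2)] by (simp add: algebra_simps)
  then show ?case
    using Suc by (simp only: power_Suc mult_minus_left mult_minus_right minus_minus mult_1_left)
qed simp

lemma mu_power_tendsto: "(\<lambda>n. \<mu> ^ n) \<longlonglongrightarrow> 0"
  using mu_less_1 by (rule LIMSEQ_power_zero)

lemma weighted_convergent_imp_null:
  assumes "(\<lambda>n. s n / \<mu> ^ n) \<longlonglongrightarrow> a"
  shows "s \<longlonglongrightarrow> 0"
  using tendsto_mult[OF assms mu_power_tendsto] mu_nz by simp

lemma three_term_casorati_0:
  assumes "three_term v s" "three_term v t" "s \<longlonglongrightarrow> 0" "t \<longlonglongrightarrow> 0"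
  shows "(- 1) ^ n * (s n * t (Suc n) - s (Suc n) * t n) = 0"
proof -
  define c where "c = s 0 * t (Suc 0) - s (Suc 0) * t 0"
  have c: "(- 1) ^ n * (s n * t (Suc n) - s (Suc n) * t n) = c" for n
    unfolding c_def by (rule three_term_casorati[OF assms(1,2)])
  have "(\<lambda>n. s n * t (Suc n) - s (Suc n) * t n) \<longlonglongrightarrow> 0 * 0 - 0 * 0"
    using assms(3,4) by (intro tendsto_intros LIMSEQ_Suc)
  then have "(\<lambda>n. norm (s n * t (Suc n) - s (Suc n) * t n)) \<longlonglongrightarrow> 0"
    by (intro tendsto_norm_zero) simp
  moreover have "norm (s n * t (Suc n) - s (Suc n) * t n) = norm c" for n
    unfolding c[of n, symmetric] by (simp add: norm_mult norm_power)
  ultimately have "(\<lambda>n :: nat. norm c) \<longlonglongrightarrow> 0" by simp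
  then have "c = 0" by (simp add: LIMSEQ_const_iff)
  then show ?thesis using c by simp
qed

text \<open>The Wronskian of \<open>s\<close> with the Jost solution is constant up to sign and tends to zero, so it
  vanishes. Far out, where the Jost solution has no zeros, \<open>s\<close> is then a constant multiple of it,
  and the constant is zero by the decay of \<open>s\<close>. The recurrence, run backwards, carries the zeros of
  \<open>s\<close> to all indices.\<close>

lemma three_term_subdominant_unique:
  assumes v: "summable (\<lambda>n. norm (v n))" and s: "three_term v s" and lim: "(\<lambda>n. s n / \<mu> ^ n) \<longlonglongrightarrow> 0"
  shows "s n = 0"
proof -
  let ?z = "jost_seq v"
  have z: "(\<lambda>n. ?z n * \<mu> / \<mu> ^ n) \<longlonglongrightarrow> 1" by (rule jost_seq_asymp[OF v])
  then have z': "(\<lambda>n. ?z n / \<mu> ^ n) \<longlonglongrightarrow> 1 / \<mu>"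
    using tendsto_divide[OF z tendsto_const[of \<mu>]] mu_nz by simp
  have "?z \<longlonglongrightarrow> 0" using weighted_convergent_imp_null[OF z'] .
  then have W: "s n * ?z (Suc n) = s (Suc n) * ?z n" for n
    using three_term_casorati_0[OF s three_term_jost[OF v] weighted_convergent_imp_null[OF lim]] by simp
  obtain N where N: "?z n \<noteq> 0" if "n \<ge> N" for n
  proof -
    have "eventually (\<lambda>n. ?z n / \<mu> ^ n \<noteq> 0) sequentially"
      using tendsto_imp_eventually_ne[OF z', of 0] mu_nz by simp
    then show ?thesis using that by (auto simp: eventually_sequentially)
  qed
  have const: "s (N + k) / ?z (N + k) = s N / ?z N" for k
  proof (induction k)
    case (Suc k)
    have "s (Suc (N + k)) / ?z (Suc (N + k)) = s (N + k) / ?z (N + k)"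
      using W[of "N + k"] N[of "N + k"] N[of "Suc (N + k)"] by (simp add: field_simps)
    then show ?case using Suc by simp
  qed simp
  have "(\<lambda>n. (s n / \<mu> ^ n) / (?z n / \<mu> ^ n)) \<longlonglongrightarrow> 0 / (1 / \<mu>)"
    using mu_nz by (intro tendsto_divide lim z') auto
  then have "(\<lambda>n. s n / ?z n) \<longlonglongrightarrow> 0" using mu_nz by simp
  then have "(\<lambda>k. s (k + N) / ?z (k + N)) \<longlonglongrightarrow> 0" by (rule LIMSEQ_ignore_initial_segment)
  then have "s N / ?z N = 0" using const by (simp add: add.commute LIMSEQ_const_iff del: divide_eq_0_iff)
  then have far: "s n = 0" if "n \<ge> N" for n
    using const[of "n - N"] N[of n] that \<open>s N / ?z N = 0\<close> by simp
  have "s (N - k) = 0 \<and> s (Suc (N - k)) = 0" for k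
  proof (induction k)
    case (Suc k)
    show ?case
    proof (cases "N - k")
      case (Suc m)
      then have "N - Suc k = m" by simp
      then show ?thesis using Suc.IH three_termD[OF s, of m] unfolding Suc by auto
    qed (use Suc in auto)
  qed (use far in auto)
  then show ?thesis using far[of n] by (metis diff_diff_cancel nat_le_linear)
qed

lemma three_term_from_0:
  assumes "three_term v s" "s 0 = 0"
  shows "s n = s (Suc 0) * reg l v n"
proof (induction n rule: induct_nat_012)
  case (ge2 n)
  show ?case unfolding three_termD[OF assms(1)] ge2 by (simp add: algebra_simps)
qed (use assms in auto)

end

section \<open>Square summable sequences and double series\<close>

lemma ell2_nth_tendsto_0:
  assumes "x \<in> ell2" shows "x \<longlonglongrightarrow> 0"
proof -
  have "(\<lambda>n. (norm (x n))\<^sup>2) \<longlonglongrightarrow> 0"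
    using assms unfolding ell2_def mem_Collect_eq by (rule summable_LIMSEQ_zero)
  then have "(\<lambda>n. sqrt ((norm (x n))\<^sup>2)) \<longlonglongrightarrow> sqrt 0" by (rule tendsto_real_sqrt)
  then show ?thesis by (simp add: tendsto_norm_zero_iff)
qed

lemma ell2_bounded:
  assumes "x \<in> ell2" obtains K where "K \<ge> 0" "\<And>n. norm (x n) \<le> K"
proof -
  have "Bseq x" using ell2_nth_tendsto_0[OF assms] by (auto intro: convergent_imp_Bseq convergentI)
  then show ?thesis using that by (meson BseqE less_imp_le)
qed

lemma ell2I_summable_norm:
  assumes "summable (\<lambda>n. norm (x n))"
  shows "x \<in> ell2"
proof -
  have "eventually (\<lambda>n. norm (x n) < 1) sequentially"
    using order_tendstoD(2)[OF summable_LIMSEQ_zero[OF assms], of 1] by simp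
  then have "eventually (\<lambda>n. norm ((norm (x n))\<^sup>2) \<le> norm (x n)) sequentially"
    by eventually_elim (simp add: power2_eq_square mult_left_le)
  then have "summable (\<lambda>n. (norm (x n))\<^sup>2)" using assms by (rule summable_comparison_test_ev)
  then show ?thesis by (simp add: ell2_def)
qed

lemma mult_le_sum_squares:
  fixes a b :: real
  shows "a * b \<le> a\<^sup>2 + b\<^sup>2"
proof -
  have "0 \<le> (a - b)\<^sup>2 + (a\<^sup>2 + b\<^sup>2)" by simp
  also have "\<dots> = 2 * (a\<^sup>2 + b\<^sup>2 - a * b)" by (simp add: power2_eq_square algebra_simps)
  finally show ?thesis by simp
qed

lemma ell2_mult_summable:
  fixes b x :: "nat \<Rightarrow> 'a::real_normed_field"
  assumes "b \<in> ell2" "x \<in> ell2"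
  shows "summable (\<lambda>n. norm (b n * x n))"
proof (rule summable_comparison_test')
  show "summable (\<lambda>n. (norm (b n))\<^sup>2 + (norm (x n))\<^sup>2)"
    using assms by (auto simp: ell2_def intro: summable_add)
  show "norm (norm (b n * x n)) \<le> (norm (b n))\<^sup>2 + (norm (x n))\<^sup>2" for n
    using mult_le_sum_squares[of "norm (b n)" "norm (x n)"] by (simp add: norm_mult)
qed

lemma ell2_mult:
  fixes c y :: "nat \<Rightarrow> 'a::real_normed_field"
  assumes "c \<in> ell2" "y \<in> ell2"
  shows "(\<lambda>n. c n * y n) \<in> ell2"
  by (intro ell2I_summable_norm ell2_mult_summable assms)

lemma ell2_diff:
  fixes x y :: "nat \<Rightarrow> 'a::real_normed_vector"
  assumes "x \<in> ell2" "y \<in> ell2"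
  shows "(\<lambda>n. x n - y n) \<in> ell2"
  unfolding ell2_def mem_Collect_eq
proof (rule summable_comparison_test')
  show "summable (\<lambda>n. 2 * (norm (x n))\<^sup>2 + 2 * (norm (y n))\<^sup>2)"
    using assms by (auto simp: ell2_def intro: summable_add summable_mult)
  fix n
  have "(norm (x n - y n))\<^sup>2 \<le> (norm (x n) + norm (y n))\<^sup>2"
    by (intro power_mono norm_triangle_ineq4) auto
  also have "\<dots> \<le> (norm (x n) + norm (y n))\<^sup>2 + (norm (x n) - norm (y n))\<^sup>2" by simp
  also have "\<dots> = 2 * (norm (x n))\<^sup>2 + 2 * (norm (y n))\<^sup>2" by (simp add: power2_eq_square algebra_simps)
  finally show "norm ((norm (x n - y n))\<^sup>2) \<le> 2 * (norm (x n))\<^sup>2 + 2 * (norm (y n))\<^sup>2" by simp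
qed

lemma basis_C_ell2: "basis_C j \<in> ell2"
  unfolding ell2_def basis_C_def mem_Collect_eq
  by (rule summable_finite[of "{j}"]) auto

lemma suminf_single:
  fixes f :: "nat \<Rightarrow> 'a::real_normed_vector"
  assumes "\<And>n. n \<noteq> k \<Longrightarrow> f n = 0"
  shows "suminf f = f k"
  using suminf_finite[of "{k}" f] assms by simp

lemma ell2_norm_single:
  assumes "\<And>n. n \<noteq> k \<Longrightarrow> f n = 0"
  shows "ell2_norm f = norm (f k)" "f \<in> ell2"
proof -
  show "ell2_norm f = norm (f k)"
    unfolding ell2_norm_def by (subst suminf_single[of k]) (use assms in auto)
  show "f \<in> ell2"
    unfolding ell2_def mem_Collect_eq by (rule summable_finite[of "{k}"]) (use assms in auto)
qed

lemma ell2_scale: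
  fixes x :: "nat \<Rightarrow> 'a::real_normed_field"
  assumes "x \<in> ell2"
  shows "(\<lambda>n. a * x n) \<in> ell2"
  using assms by (simp add: ell2_def norm_mult power_mult_distrib summable_mult)

lemma ell2_norm_square:
  assumes "x \<in> ell2"
  shows "(ell2_norm x)\<^sup>2 = (\<Sum>n. (norm (x n))\<^sup>2)"
  using assms by (simp add: ell2_norm_def ell2_def suminf_nonneg)

lemma norm_nth_le_ell2_norm:
  assumes "x \<in> ell2"
  shows "norm (x n) \<le> ell2_norm x"
proof -
  have "(\<Sum>k\<in>{n}. (norm (x k))\<^sup>2) \<le> (\<Sum>k. (norm (x k))\<^sup>2)"
    using assms unfolding ell2_def by (intro sum_le_suminf) auto
  then have "sqrt ((norm (x n))\<^sup>2) \<le> ell2_norm x"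
    unfolding ell2_norm_def by (intro real_sqrt_le_mono) simp
  then show ?thesis by simp
qed

text \<open>Allows tails of \<open>x\<close> to be estimated by the same tails of a fixed \<open>y\<close>, uniformly in the cut-off
  \<open>m\<close>.\<close>

lemma ell2_tail_split:
  fixes x y :: "nat \<Rightarrow> complex"
  assumes x: "x \<in> ell2" and y: "y \<in> ell2"
  shows "(\<Sum>n. (norm (x (n + m)))\<^sup>2) \<le> 2 * (\<Sum>n. (norm (y (n + m)))\<^sup>2) + 2 * (\<Sum>n. (norm (x n - y n))\<^sup>2)"
proof -
  let ?s = "\<lambda>z :: nat \<Rightarrow> complex. \<lambda>n. (norm (z n))\<^sup>2"
  have sd: "summable (?s (\<lambda>n. x n - y n))" using ell2_diff[OF x y] by (simp add: ell2_def)
  have sx: "summable (?s x)" and sy: "summable (?s y)" using x y by (auto simp: ell2_def)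
  have shx: "summable (\<lambda>n. ?s x (n + m))" and shy: "summable (\<lambda>n. ?s y (n + m))"
    and shd: "summable (\<lambda>n. ?s (\<lambda>n. x n - y n) (n + m))"
    using summable_ignore_initial_segment[OF sx, of m] summable_ignore_initial_segment[OF sy, of m]
      summable_ignore_initial_segment[OF sd, of m] by simp_all
  have pt: "?s x n \<le> 2 * ?s y n + 2 * ?s (\<lambda>n. x n - y n) n" for n
  proof -
    have "norm (x n) \<le> norm (y n) + norm (x n - y n)"
      using norm_triangle_ineq[of "y n" "x n - y n"] by simp
    then have "?s x n \<le> (norm (y n) + norm (x n - y n))\<^sup>2" by (intro power_mono) auto
    also have "\<dots> \<le> (norm (y n) + norm (x n - y n))\<^sup>2 + (norm (y n) - norm (x n - y n))\<^sup>2" by simp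
    also have "\<dots> = 2 * ?s y n + 2 * ?s (\<lambda>n. x n - y n) n" by (simp add: power2_eq_square algebra_simps)
    finally show ?thesis .
  qed
  have "(\<Sum>n. ?s x (n + m)) \<le> (\<Sum>n. 2 * ?s y (n + m) + 2 * ?s (\<lambda>n. x n - y n) (n + m))"
    by (intro suminf_le pt shx summable_add summable_mult shy shd)
  also have "\<dots> = 2 * (\<Sum>n. ?s y (n + m)) + 2 * (\<Sum>n. ?s (\<lambda>n. x n - y n) (n + m))"
    using shy shd by (simp add: suminf_add[symmetric] suminf_mult summable_mult)
  also have "(\<Sum>n. ?s (\<lambda>n. x n - y n) (n + m)) \<le> (\<Sum>n. ?s (\<lambda>n. x n - y n) n)"
    using suminf_split_initial_segment[OF sd, of m] sum_nonneg[of "{..<m}" "?s (\<lambda>n. x n - y n)"] by simp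
  finally show ?thesis by simp
qed

lemma double_series_swap:
  fixes f :: "nat \<Rightarrow> nat \<Rightarrow> 'a::banach"
  assumes "(\<lambda>nk. norm (case nk of (n, k) \<Rightarrow> f n k)) summable_on UNIV \<times> UNIV"
  shows "(\<lambda>k. \<Sum>n. f n k) sums (\<Sum>n. \<Sum>k. f n k)"
proof -
  have row: "(\<lambda>k. f n k) summable_on UNIV" for n
  proof -
    have "(\<lambda>(n, k). f n k) summable_on (UNIV \<times> UNIV)" using assms by (rule Infinite_Sum.abs_summable_summable)
    then have "(\<lambda>(n, k). f n k) summable_on (Pair n ` UNIV)"
      by (rule summable_on_subset_banach) auto
    then show ?thesis by (subst (asm) summable_on_reindex) (auto simp: o_def inj_on_def)
  qed
  have swap: "(\<lambda>(k, n). f n k) summable_on (UNIV \<times> UNIV)"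
    using Infinite_Sum.abs_summable_summable[OF assms] summable_on_reindex_bij_betw[of prod.swap "UNIV \<times> UNIV" "UNIV \<times> UNIV" "\<lambda>(n, k). f n k"]
    by (simp add: case_prod_unfold bij_swap)
  have col: "(\<lambda>n. f n k) summable_on UNIV" for k
  proof -
    have "(\<lambda>(k, n). f n k) summable_on (Pair k ` UNIV)"
      using swap by (rule summable_on_subset_banach) auto
    then show ?thesis by (subst (asm) summable_on_reindex) (auto simp: o_def inj_on_def)
  qed
  have s: "suminf g = infsum g UNIV" if "g summable_on UNIV" for g :: "nat \<Rightarrow> 'a"
    using has_sum_imp_sums[OF has_sum_infsum[OF that]] by (simp add: sums_iff)
  have "(\<lambda>k. \<Sum>\<^sub>\<infinity>n. f n k) summable_on UNIV"
    using summable_on_Sigma_banach[OF swap] by simp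
  then have "(\<lambda>k. \<Sum>\<^sub>\<infinity>n. f n k) sums (\<Sum>\<^sub>\<infinity>k. \<Sum>\<^sub>\<infinity>n. f n k)"
    by (intro has_sum_imp_sums has_sum_infsum)
  also have "(\<Sum>\<^sub>\<infinity>k. \<Sum>\<^sub>\<infinity>n. f n k) = (\<Sum>\<^sub>\<infinity>n. \<Sum>\<^sub>\<infinity>k. f n k)"
    using infsum_swap_banach[OF Infinite_Sum.abs_summable_summable[OF assms]] by simp
  also have "\<dots> = (\<Sum>n. \<Sum>\<^sub>\<infinity>k. f n k)"
    using summable_on_Sigma_banach[OF Infinite_Sum.abs_summable_summable[OF assms]] by (intro s[symmetric]) simp
  finally show ?thesis by (simp add: s row col)
qed

section \<open>The resolvent of the free operator\<close>

context char_root
begin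

lemma norm_green_le: "norm (green i j) \<le> C * norm \<mu> ^ (max i j - min i j)"
proof -
  have "\<mu> ^ Suc (max i j) = \<mu> ^ Suc (min i j) * \<mu> ^ (max i j - min i j)"
    unfolding power_add[symmetric] by (intro arg_cong2[where f = power] refl) simp
  then have "norm (green i j) = norm (h (Suc (min i j))) * norm \<mu> ^ Suc (min i j) * norm \<mu> ^ (max i j - min i j)"
    unfolding green_def by (simp only: norm_mult norm_power mult_ac)
  also have "\<dots> \<le> C * norm \<mu> ^ (max i j - min i j)"
    by (intro mult_right_mono norm_h_le) auto
  finally show ?thesis .
qed

lemma norm_green_le_C: "norm (green i j) \<le> C"
proof -
  have "C * norm \<mu> ^ (max i j - min i j) \<le> C * 1"
    using mu_less_1 C_pos by (intro mult_left_mono power_le_one) auto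
  then show ?thesis using norm_green_le[of i j] by linarith
qed

text \<open>Geometric decay off the diagonal makes a kernel summable along each row, uniformly in the row.\<close>

lemma decay_summable_suminf:
  shows decay_summable: "summable (\<lambda>j. norm \<mu> ^ (max i j - min i j))"
    and decay_suminf_le: "(\<Sum>j. norm \<mu> ^ (max i j - min i j)) \<le> 2 / (1 - norm \<mu>)"
proof -
  let ?r = "norm \<mu>" let ?f = "\<lambda>j. ?r ^ (max i j - min i j)"
  have sh: "(\<lambda>j. ?f (j + i)) = (\<lambda>j. ?r ^ j)" by (auto simp: max_def min_def fun_eq_iff)
  have g: "summable (\<lambda>j. ?r ^ j)" "(\<Sum>j. ?r ^ j) = 1 / (1 - ?r)"
    using mu_less_1 by (auto intro: summable_geometric suminf_geometric)
  show 1: "summable ?f" using g(1) summable_iff_shift[of ?f i] unfolding sh by blast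
  have "(\<Sum>j<i. ?f j) = (\<Sum>j<i. ?r ^ Suc j)"
    by (intro sum.reindex_bij_witness[of _ "\<lambda>j. i - Suc j" "\<lambda>j. i - Suc j"]) (auto simp: max_def min_def Suc_diff_Suc)
  also have "\<dots> \<le> (\<Sum>j<i. ?r ^ j)"
    using mu_less_1 by (intro sum_mono power_decreasing) auto
  also have "\<dots> \<le> (\<Sum>j. ?r ^ j)" using g(1) by (intro sum_le_suminf) auto
  finally have "(\<Sum>j<i. ?f j) \<le> 1 / (1 - ?r)" unfolding g(2) .
  moreover have "suminf ?f = 1 / (1 - ?r) + (\<Sum>j<i. ?f j)"
    using suminf_split_initial_segment[OF 1, of i] unfolding sh g(2) .
  ultimately show "suminf ?f \<le> 2 / (1 - ?r)" by (simp add: add_divide_distrib[symmetric])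
qed

text \<open>The source of all interchanges of summation below: a weight in either of the two indices
  together with geometric decay off the diagonal.\<close>

lemma decay_weighted_summable:
  assumes "summable a" "\<And>n. a n \<ge> (0::real)"
  shows "(\<lambda>(i, j). norm \<mu> ^ (max i j - min i j) * a i) summable_on UNIV \<times> UNIV"
    "(\<lambda>(i, j). norm \<mu> ^ (max i j - min i j) * a j) summable_on UNIV \<times> UNIV"
proof -
  let ?S = "\<lambda>i. \<Sum>j. norm \<mu> ^ (max i j - min i j)"
  have S0: "?S i \<ge> 0" for i by (intro suminf_nonneg decay_summable) auto
  have row: "((\<lambda>j. norm \<mu> ^ (max i j - min i j) * a i) has_sum ?S i * a i) UNIV" for i
    by (intro sums_nonneg_imp_has_sum sums_mult2 summable_sums decay_summable) (use assms in auto)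
  have "summable (\<lambda>i. ?S i * a i)"
  proof (rule summable_comparison_test')
    show "summable (\<lambda>i. 2 / (1 - norm \<mu>) * a i)" by (intro summable_mult assms)
    show "norm (?S i * a i) \<le> 2 / (1 - norm \<mu>) * a i" for i
    proof -
      have "norm (?S i * a i) = ?S i * a i" using S0[of i] assms(2)[of i] by simp
      then show ?thesis using mult_right_mono[OF decay_suminf_le[of i] assms(2)[of i]] by linarith
    qed
  qed
  then have "(\<lambda>i. ?S i * a i) summable_on UNIV"
    using S0 assms(2) by (intro norm_summable_imp_summable_on) (simp add: abs_mult)
  then show *: "(\<lambda>(i, j). norm \<mu> ^ (max i j - min i j) * a i) summable_on UNIV \<times> UNIV"
    by (intro summable_on_SigmaI[OF _ _]) (use row assms(2) in auto)
  show "(\<lambda>(i, j). norm \<mu> ^ (max i j - min i j) * a j) summable_on UNIV \<times> UNIV"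
    using * summable_on_reindex_bij_betw[of prod.swap "UNIV \<times> UNIV" "UNIV \<times> UNIV" "\<lambda>(i, j). norm \<mu> ^ (max i j - min i j) * a i"]
    by (simp add: case_prod_unfold bij_swap max.commute min.commute)
qed

text \<open>The inverse of \<open>S - S\<^sup>-\<^sup>1 - \<lambda>\<close>, for summable \<open>f\<close>. The products \<open>b\<^sub>n x\<^sub>n\<close> with square
  summable \<open>x\<close> are summable, so that bounds in \<open>\<ell>\<^sup>1\<close> suffice.\<close>

definition G :: "(nat \<Rightarrow> complex) \<Rightarrow> nat \<Rightarrow> complex" where
  "G f n = (\<Sum>m. - ((- 1) ^ m * green n m * f m))"

lemma G_summand_summable:
  assumes "summable (\<lambda>n. norm (f n))"
  shows "summable (\<lambda>m. norm (- ((- 1) ^ m * green n m * f m)))"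
proof (rule summable_comparison_test')
  show "summable (\<lambda>m. C * norm (f m))" by (intro summable_mult assms)
  show "norm (norm (- ((- 1) ^ m * green n m * f m))) \<le> C * norm (f m)" for m
    using mult_right_mono[OF norm_green_le_C[of n m] norm_ge_zero[of "f m"]]
    by (simp add: norm_mult norm_power)
qed

lemma summable_G:
  assumes "summable (\<lambda>n. norm (f n))"
  shows "summable (\<lambda>n. norm (G f n))"
proof (rule summable_comparison_test')
  let ?F = "\<lambda>n m. C * (norm \<mu> ^ (max n m - min n m) * norm (f m))"
  have "(\<lambda>(n, m). ?F n m) summable_on UNIV \<times> UNIV"
    using summable_on_cmult_right[OF decay_weighted_summable(2)[of "\<lambda>m. norm (f m)"], of C] assms
    by (simp add: case_prod_unfold)
  then have "(\<lambda>mn. norm (case mn of (m, n) \<Rightarrow> ?F n m)) summable_on UNIV \<times> UNIV"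
    using summable_on_reindex_bij_betw[of prod.swap "UNIV \<times> UNIV" "UNIV \<times> UNIV" "\<lambda>(n, m). ?F n m"] C_pos
    by (simp add: case_prod_unfold bij_swap abs_mult)
  then show "summable (\<lambda>n. \<Sum>m. ?F n m)" using double_series_swap[of "\<lambda>m n. ?F n m"] by (simp add: sums_iff)
  fix n
  have sF: "summable (\<lambda>m. ?F n m)"
  proof (rule summable_comparison_test')
    show "summable (\<lambda>m. C * norm (f m))" by (intro summable_mult assms)
    show "norm (?F n m) \<le> C * norm (f m)" for m
    proof -
      have "norm \<mu> ^ (max n m - min n m) * norm (f m) \<le> norm (f m)"
        using mu_less_1 by (intro mult_left_le_one_le power_le_one) auto
      then show ?thesis using C_pos by (simp add: abs_mult)
    qed
  qed
  have "norm (G f n) \<le> (\<Sum>m. norm (- ((- 1) ^ m * green n m * f m)))"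
    unfolding G_def by (rule summable_norm[OF G_summand_summable[OF assms]])
  also have "\<dots> \<le> (\<Sum>m. ?F n m)"
  proof (rule suminf_le[OF _ G_summand_summable[OF assms] sF])
    show "norm (- ((- 1) ^ m * green n m * f m)) \<le> ?F n m" for m
      using mult_right_mono[OF norm_green_le[of n m], of "norm (f m)"] by (simp add: norm_mult norm_power mult_ac)
  qed
  finally show "norm (norm (G f n)) \<le> (\<Sum>m. ?F n m)" by simp
qed

lemma green_difference:
  "(case n of 0 \<Rightarrow> 0 | Suc n' \<Rightarrow> green n' m) - green (Suc n) m - l * green n m = (if m = n then - ((- 1) ^ n) else 0)"
proof -
  consider "m < n" | "m = n" | "m > n" by linarith
  then show ?thesis
  proof cases
    case 1
    then obtain n' where n: "n = Suc n'" "m \<le> n'" by (cases n) auto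
    have "green n' m - green (Suc n) m - l * green n m =
      (\<mu> ^ Suc n' - l * \<mu> ^ Suc (Suc n') - \<mu> ^ Suc (Suc (Suc n'))) * h (Suc m)"
      using n by (simp add: green_def algebra_simps)
    also have "\<dots> = 0" unfolding mu_power_rec[of "Suc n'"] by simp
    finally show ?thesis using 1 n by simp
  next
    case 2
    have "(case n of 0 \<Rightarrow> 0 | Suc n' \<Rightarrow> green n' n) = \<mu> ^ Suc n * h n"
      by (cases n) (auto simp: green_def)
    moreover have "green (Suc n) n + l * green n n = \<mu> ^ n * h (Suc n)"
    proof -
      have "green (Suc n) n + l * green n n = (\<mu> ^ Suc (Suc n) + l * \<mu> ^ Suc n) * h (Suc n)"
        by (simp add: green_def algebra_simps)
      then show ?thesis unfolding mu_power_rec by simp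
    qed
    ultimately show ?thesis unfolding 2 using h_casorati[of n] by (simp add: algebra_simps)
  next
    case 3
    have "(case n of 0 \<Rightarrow> 0 | Suc n' \<Rightarrow> green n' m) = \<mu> ^ Suc m * h n"
      using 3 by (cases n) (auto simp: green_def)
    moreover have "green (Suc n) m = \<mu> ^ Suc m * (h n - l * h (Suc n))"
      using 3 by (simp add: green_def h_rec max_def min_def)
    moreover have "green n m = \<mu> ^ Suc m * h (Suc n)" using 3 by (simp add: green_def)
    ultimately show ?thesis using 3 by (simp add: algebra_simps)
  qed
qed

lemma G_right_inverse:
  assumes f: "summable (\<lambda>n. norm (f n))"
  shows "right_shift (G f) n - left_shift (G f) n - l * G f n = f n"
proof -
  let ?g = "\<lambda>k m. - ((- 1) ^ m * green k m * f m)"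
  have s: "summable (?g k)" for k using G_summand_summable[OF f] by (rule summable_norm_cancel)
  have 1: "right_shift (G f) n = (\<Sum>m. case n of 0 \<Rightarrow> 0 | Suc k \<Rightarrow> ?g k m)" "summable (\<lambda>m. case n of 0 \<Rightarrow> 0 | Suc k \<Rightarrow> ?g k m)"
    using s by (cases n; simp add: right_shift_def G_def)+
  have "right_shift (G f) n - left_shift (G f) n - l * G f n =
     (\<Sum>m. (case n of 0 \<Rightarrow> 0 | Suc k \<Rightarrow> ?g k m) - ?g (Suc n) m - l * ?g n m)"
    unfolding 1(1) left_shift_def G_def
    by (rule sums_unique) (intro sums_diff sums_mult summable_sums 1(2) s)
  also have "(\<lambda>m. (case n of 0 \<Rightarrow> 0 | Suc k \<Rightarrow> ?g k m) - ?g (Suc n) m - l * ?g n m) =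
     (\<lambda>m. - ((- 1) ^ m * f m) * ((case n of 0 \<Rightarrow> 0 | Suc n' \<Rightarrow> green n' m) - green (Suc n) m - l * green n m))"
    by (auto simp: fun_eq_iff algebra_simps split: nat.split)
  also have "\<dots> = (\<lambda>m. if m = n then f n else 0)"
    unfolding green_difference by (auto simp: fun_eq_iff)
  also have "suminf \<dots> = f n" by (subst suminf_single[of n]) auto
  finally show ?thesis .
qed

text \<open>A solution of the free equation that vanishes at \<open>-1\<close> is \<open>z\<^sub>0\<close> times \<open>h\<close>; its Wronskian with
  \<open>\<mu>\<^sup>n\<close> has modulus \<open>\<bar>z\<^sub>0\<bar>\<close> and tends to zero if \<open>z\<close> is square summable.\<close>

lemma homogeneous_ell2_zero:
  assumes "z \<in> ell2" "\<And>n. right_shift z n - left_shift z n - l * z n = 0"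
  shows "z n = 0"
proof -
  have eq: "z n = z 0 * h (Suc n) \<and> z (Suc n) = z 0 * h (Suc (Suc n))" for n
  proof (induction n)
    case 0
    have "- z (Suc 0) = l * z 0"
      using assms(2)[of 0] by (simp add: right_shift_def left_shift_def)
    then have "z (Suc 0) = - (l * z 0)" by (metis minus_minus)
    then show ?case by (simp add: h_rec)
  next
    case (Suc n)
    have "z (Suc (Suc n)) = z n - l * z (Suc n)"
      using assms(2)[of "Suc n"] by (simp add: right_shift_def left_shift_def algebra_simps)
    then have "z (Suc (Suc n)) = z 0 * h (Suc n) - l * (z 0 * h (Suc (Suc n)))" using Suc by simp
    then show ?case unfolding h_rec[of "Suc n"] using Suc by (simp add: algebra_simps)
  qed
  have "z (Suc n) * \<mu> ^ Suc n - \<mu> ^ Suc (Suc n) * z n = z 0 * (- 1) ^ Suc n" for n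
    using eq[of n] unfolding h_casorati[of "Suc n", symmetric] by (simp add: algebra_simps)
  moreover have "(\<lambda>n. z (Suc n) * \<mu> ^ Suc n - \<mu> ^ Suc (Suc n) * z n) \<longlonglongrightarrow> 0 * 0 - 0 * 0"
    using mu_less_1 by (intro tendsto_intros LIMSEQ_Suc ell2_nth_tendsto_0[OF assms(1)] LIMSEQ_power_zero)
  ultimately have "(\<lambda>n. norm (z 0 * (- 1) ^ Suc n)) \<longlonglongrightarrow> 0"
    by (intro tendsto_norm_zero) simp
  then have "z 0 = 0" by (simp add: norm_mult norm_power LIMSEQ_const_iff)
  then show ?thesis using eq[of n] by auto
qed

lemma inv_into_G:
  assumes f: "summable (\<lambda>n. norm (f n))"
  shows "inv_into ell2 (\<lambda>z m. right_shift z m - left_shift z m - l * z m) f = G f"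
proof (rule inv_into_f_eq)
  show "inj_on (\<lambda>z m. right_shift z m - left_shift z m - l * z m) ell2"
  proof (rule inj_onI)
    fix x y :: "nat \<Rightarrow> complex"
    assume xy: "x \<in> ell2" "y \<in> ell2"
      "(\<lambda>m. right_shift x m - left_shift x m - l * x m) = (\<lambda>m. right_shift y m - left_shift y m - l * y m)"
    have "right_shift (\<lambda>n. x n - y n) m - left_shift (\<lambda>n. x n - y n) m - l * (x m - y m) = 0" for m
      using fun_cong[OF xy(3), of m] by (auto simp: right_shift_def left_shift_def algebra_simps split: nat.splits)
    then have "x n - y n = 0" for n
      using homogeneous_ell2_zero[OF ell2_diff[OF xy(1,2)]] by blast
    then show "x = y" by auto
  qed
  show "G f \<in> ell2" by (intro ell2I_summable_norm summable_G f)
  show "(\<lambda>m. right_shift (G f) m - left_shift (G f) m - l * G f m) = f"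
    by (intro ext G_right_inverse f)
qed

end

section \<open>The operator \<open>K\<^sub>\<lambda>\<^sup>+\<close>\<close>

context char_root
begin

context
  fixes b c :: "nat \<Rightarrow> complex"
  assumes b: "b \<in> ell2" and c: "c \<in> ell2"
begin

abbreviation kernel :: "nat \<Rightarrow> nat \<Rightarrow> complex" where
  "kernel n k \<equiv> c n * (b k * (- 1) ^ k) * green n k"

lemma K_plus_eq:
  assumes "x \<in> ell2"
  shows "K_plus b c l x = (\<lambda>n. - c n * G (\<lambda>m. b m * x m) n)"
  unfolding K_plus_def inv_into_G[OF ell2_mult_summable[OF b assms]] ..

lemma K_plus_series:
  assumes "x \<in> ell2"
  shows "K_plus b c l x n = (\<Sum>k. kernel n k * x k)"
  unfolding K_plus_eq[OF assms] G_def
  using summable_norm_cancel[OF G_summand_summable[OF ell2_mult_summable[OF b assms]], of n]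
  by (subst suminf_mult[symmetric]) (auto simp: mult_ac)

lemma K_plus_ell2: "x \<in> ell2 \<Longrightarrow> K_plus b c l x \<in> ell2"
  unfolding K_plus_eq
  using ell2_mult[OF c ell2I_summable_norm[OF summable_G[OF ell2_mult_summable[OF b]]], of x]
  by (simp add: ell2_def norm_mult)

lemma K_plus_matrix: "inner_C (K_plus b c l (basis_C j)) (basis_C i) = kernel i j"
  unfolding inner_C_def K_plus_series[OF basis_C_ell2]
  by (subst suminf_single[of i]; (subst suminf_single[of j])?) (auto simp: basis_C_def)

lemma K_plus_minor:
  assumes "finite F"
  shows "principal_minor (\<lambda>i j. inner_C (K_plus b c l (basis_C j)) (basis_C i)) F = minor (\<lambda>n. b n * c n) F"
  unfolding K_plus_matrix minor_def principal_minor_scale[OF assms] by (simp add: mult_ac)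

text \<open>Column \<open>k\<close> of the matrix gives the rank one term \<open>x \<mapsto> b\<^sub>k x\<^sub>k g\<^sub>k\<close> with
  \<open>g\<^sub>k = (c\<^sub>n (-1)\<^sup>k green n k)\<^sub>n\<close>. The norms of the \<open>g\<^sub>k\<close> are square summable by the decay of the
  Green kernel, hence summable against \<open>\<bar>b\<^sub>k\<bar>\<close>.\<close>

lemma K_plus_trace_class: "trace_class inner_C (K_plus b c l)"
proof -
  define f where "f k = (\<lambda>n. if n = k then cnj (b k) else 0)" for k :: nat
  define g where "g k = (\<lambda>n. c n * (- 1) ^ k * green n k)" for k :: nat
  have sb: "summable (\<lambda>n. (norm (b n))\<^sup>2)" and sc: "summable (\<lambda>n. (norm (c n))\<^sup>2)"
    using b c by (auto simp: ell2_def)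
  have f: "f k \<in> ell2" "ell2_norm (f k) = norm (b k)" for k
    using ell2_norm_single[of k "f k"] by (auto simp: f_def)
  have g: "g k \<in> ell2" for k
    unfolding ell2_def mem_Collect_eq
  proof (rule summable_comparison_test')
    show "summable (\<lambda>n. C\<^sup>2 * (norm (c n))\<^sup>2)" by (intro summable_mult sc)
    show "norm ((norm (g k n))\<^sup>2) \<le> C\<^sup>2 * (norm (c n))\<^sup>2" for n
      using mult_left_mono[OF power_mono[OF norm_green_le_C[of n k], of 2] zero_le_power2[of "norm (c n)"]]
      by (simp add: g_def norm_mult norm_power power_mult_distrib mult.commute)
  qed
  let ?d = "\<lambda>n k. norm \<mu> ^ (max n k - min n k)"
  have "summable (\<lambda>k. (ell2_norm (g k))\<^sup>2)"
  proof -
    have "(\<lambda>nk. norm (case nk of (n, k) \<Rightarrow> (norm (g k n))\<^sup>2)) summable_on UNIV \<times> UNIV"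
    proof (rule Infinite_Sum.abs_summable_on_comparison_test')
      show "(\<lambda>(n, k). C\<^sup>2 * (?d n k * (norm (c n))\<^sup>2)) summable_on UNIV \<times> UNIV"
        using summable_on_cmult_right[OF decay_weighted_summable(1)[OF sc], of "C\<^sup>2"]
        by (simp add: case_prod_unfold)
      fix nk :: "nat \<times> nat"
      obtain n k where nk: "nk = (n, k)" by (cases nk)
      have "(norm (green n k))\<^sup>2 \<le> C * (C * ?d n k)"
        unfolding power2_eq_square using C_pos
        by (intro mult_mono norm_green_le norm_green_le_C) auto
      then have "(norm (c n))\<^sup>2 * (norm (green n k))\<^sup>2 \<le> (norm (c n))\<^sup>2 * (C * (C * ?d n k))"
        by (rule mult_left_mono) auto
      then show "norm (case nk of (n, k) \<Rightarrow> (norm (g k n))\<^sup>2) \<le> (case nk of (n, k) \<Rightarrow> C\<^sup>2 * (?d n k * (norm (c n))\<^sup>2))"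
        by (simp add: nk g_def norm_mult norm_power power_mult_distrib mult_ac power2_eq_square)
    qed
    then have "summable (\<lambda>k. \<Sum>n. (norm (g k n))\<^sup>2)" using double_series_swap[of "\<lambda>n k. (norm (g k n))\<^sup>2"] by (simp add: sums_iff)
    then show ?thesis using g by (simp add: ell2_norm_def ell2_def suminf_nonneg)
  qed
  then have "(\<lambda>k. ell2_norm (g k)) \<in> ell2" by (simp add: ell2_def)
  moreover have "(\<lambda>k. norm (b k)) \<in> ell2" using b by (simp add: ell2_def)
  ultimately have "summable (\<lambda>k. norm (norm (b k) * ell2_norm (g k)))" by (intro ell2_mult_summable)
  then have sfg: "summable (\<lambda>k. ell2_norm (f k) * ell2_norm (g k))" unfolding f by (rule summable_norm_cancel)
  have "(\<lambda>k. inner_C x (f k) * inner_C (g k) y) sums inner_C (K_plus b c l x) y" if xy: "x \<in> ell2" "y \<in> ell2" for x y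
  proof -
    obtain X where X: "X \<ge> 0" "\<And>n. norm (x n) \<le> X" using ell2_bounded[OF xy(1)] by blast
    obtain Y where Y: "Y \<ge> 0" "\<And>n. norm (y n) \<le> Y" using ell2_bounded[OF xy(2)] by blast
    let ?F = "\<lambda>n k. kernel n k * x k * cnj (y n)"
    have "(\<lambda>nk. norm (case nk of (n, k) \<Rightarrow> ?F n k)) summable_on UNIV \<times> UNIV"
    proof (rule Infinite_Sum.abs_summable_on_comparison_test')
      have "(\<lambda>(n, k). C * X * Y * (?d n k * (norm (c n))\<^sup>2) + C * X * Y * (?d n k * (norm (b k))\<^sup>2)) summable_on UNIV \<times> UNIV"
        using summable_on_add[OF summable_on_cmult_right[OF decay_weighted_summable(1)[OF sc], of "C * X * Y"]
            summable_on_cmult_right[OF decay_weighted_summable(2)[OF sb], of "C * X * Y"]]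
        by (simp add: case_prod_unfold)
      then show "(\<lambda>(n, k). C * X * Y * (?d n k * (norm (c n))\<^sup>2) + C * X * Y * (?d n k * (norm (b k))\<^sup>2)) summable_on UNIV \<times> UNIV" .
      fix nk :: "nat \<times> nat"
      obtain n k where nk: "nk = (n, k)" by (cases nk)
      have bc: "norm (c n) * norm (b k) \<le> (norm (c n))\<^sup>2 + (norm (b k))\<^sup>2"
        by (rule mult_le_sum_squares)
      have "norm (?F n k) = (norm (c n) * norm (b k)) * (norm (green n k) * (norm (x k) * norm (y n)))"
        by (simp add: norm_mult norm_power mult_ac)
      also have "\<dots> \<le> ((norm (c n))\<^sup>2 + (norm (b k))\<^sup>2) * ((C * ?d n k) * (X * Y))"
        using C_pos X Y by (intro mult_mono bc norm_green_le) auto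
      finally show "norm (case nk of (n, k) \<Rightarrow> ?F n k) \<le> (case nk of (n, k) \<Rightarrow> C * X * Y * (?d n k * (norm (c n))\<^sup>2) + C * X * Y * (?d n k * (norm (b k))\<^sup>2))"
        by (simp add: nk algebra_simps)
    qed
    then have "(\<lambda>k. \<Sum>n. ?F n k) sums (\<Sum>n. \<Sum>k. ?F n k)" by (rule double_series_swap)
    also have "(\<Sum>n. \<Sum>k. ?F n k) = inner_C (K_plus b c l x) y"
      unfolding inner_C_def
    proof (rule suminf_cong)
      fix n
      have "summable (\<lambda>k. kernel n k * x k)"
        using summable_mult[OF summable_norm_cancel[OF G_summand_summable[OF ell2_mult_summable[OF b xy(1)]], of n], of "- c n"]
        by (simp add: mult_ac)
      then show "(\<Sum>k. ?F n k) = K_plus b c l x n * cnj (y n)"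
        unfolding K_plus_series[OF xy(1)] by (rule suminf_mult2[symmetric])
    qed
    also have "(\<lambda>k. \<Sum>n. ?F n k) = (\<lambda>k. inner_C x (f k) * inner_C (g k) y)"
    proof
      fix k
      have "inner_C x (f k) = x k * b k"
        unfolding inner_C_def by (subst suminf_single[of k]) (auto simp: f_def)
      moreover have "summable (\<lambda>n. g k n * cnj (y n))"
        using xy(2) ell2_mult_summable[OF g[of k], of "\<lambda>n. cnj (y n)"] by (auto simp: ell2_def intro: summable_norm_cancel)
      then have "(\<Sum>n. x k * b k * (g k n * cnj (y n))) = x k * b k * inner_C (g k) y"
        unfolding inner_C_def by (rule suminf_mult)
      ultimately show "(\<Sum>n. ?F n k) = inner_C x (f k) * inner_C (g k) y"
        by (simp add: g_def mult_ac)
    qed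
    finally show ?thesis .
  qed
  then show ?thesis unfolding trace_class_def using f(1) g sfg K_plus_ell2 by blast
qed

end
end

section \<open>The operator \<open>T\<^sub>\<lambda>\<^sup>+\<close>\<close>

lemma scaled_Q_mult_vec: "scaled_Q a *v x = vector [a * x $ 1, 0]"
  by (simp add: scaled_Q_def Q_plus_def vec_eq_iff forall_2 matrix_vector_mult_def matrix_matrix_mult_def mat_def sum_2)

lemma A_mat_mult_vec: "A_mat l *v x = vector [x $ 2 - l * x $ 1, x $ 1]"
  by (simp add: A_mat_def vec_eq_iff forall_2 matrix_vector_mult_def sum_2)

lemma range_Q_plus: "range ((*v) Q_plus) = {x. x $ 2 = 0}"
proof -
  have eq: "Q_plus *v x = vector [x $ 1, 0]" for x
    by (simp add: Q_plus_def vec_eq_iff forall_2 matrix_vector_mult_def sum_2)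
  show ?thesis
  proof (intro set_eqI iffI)
    fix x :: "complex^2" assume "x \<in> {x. x $ 2 = 0}"
    then have "x = Q_plus *v x" by (simp add: eq vec_eq_iff forall_2)
    then show "x \<in> range ((*v) Q_plus)" by blast
  qed (auto simp: eq)
qed

text \<open>The isometric embedding of scalar sequences as first components.\<close>

definition emb :: "(nat \<Rightarrow> complex) \<Rightarrow> nat \<Rightarrow> complex^2" where
  "emb f = (\<lambda>n. vector [f n, 0])"

lemma norm_vector2: "(norm (x :: complex^2))\<^sup>2 = (norm (x $ 1))\<^sup>2 + (norm (x $ 2))\<^sup>2"
  by (simp add: norm_vec_def L2_set_def sum_2)

lemma emb_ell2: "emb f \<in> ell2 \<longleftrightarrow> f \<in> ell2" "ell2_norm (emb f) = ell2_norm f"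
  by (simp_all add: ell2_def ell2_norm_def emb_def norm_vector2)

lemma nth_ell2:
  fixes x :: "nat \<Rightarrow> complex^2"
  assumes "x \<in> ell2"
  shows "(\<lambda>n. x n $ i) \<in> ell2"
  unfolding ell2_def mem_Collect_eq
proof (rule summable_comparison_test')
  show "summable (\<lambda>n. (norm (x n))\<^sup>2)" using assms by (simp add: ell2_def)
  show "norm ((norm (x n $ i))\<^sup>2) \<le> (norm (x n))\<^sup>2" for n
    using Finite_Cartesian_Product.norm_nth_le[of "x n" i] by (simp add: power_mono)
qed

lemma inner_C2_emb: "inner_C2 (emb f) y = inner_C f (\<lambda>n. y n $ 1)" "inner_C2 x (emb g) = inner_C (\<lambda>n. x n $ 1) g"
  by (simp_all add: inner_C2_def inner_C_def emb_def sum_2)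

lemma emb_nth [simp]: "emb f n $ 1 = f n" "emb f n $ 2 = 0"
  by (simp_all add: emb_def)

lemma basis_C2_nth1: "(\<lambda>n. basis_C2 (j, i) n $ 1) = (if i = 1 then basis_C j else (\<lambda>n. 0))"
  by (auto simp: basis_C2_def basis_C_def axis_def fun_eq_iff)

lemma basis_C2_ell2: "basis_C2 ji \<in> ell2"
  unfolding ell2_def basis_C2_def mem_Collect_eq
  by (rule summable_finite[of "{fst ji}"]) auto

context char_root
begin

context
  fixes b c :: "nat \<Rightarrow> complex"
  assumes b: "b \<in> ell2" and c: "c \<in> ell2"
begin

theorem det_K_plus_eq: "det_K_plus b c l = jost_fun (\<lambda>n. b n * c n)"
proof -
  have "trace_ext_power inner_C basis_C k (K_plus b c l) =
     (\<Sum>\<^sub>\<infinity>F\<in>{F. finite F \<and> card F = k}. minor (\<lambda>n. b n * c n) F)" for k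
    unfolding trace_ext_power_def by (rule infsum_cong) (simp add: K_plus_minor[OF b c])
  then show ?thesis
    using jost_fun_fredholm[OF ell2_mult_summable[OF b c]] K_plus_trace_class[OF b c]
    by (simp add: det_K_plus_def fredholm_det_I_minus_def)
qed

text \<open>The second row of \<open>y\<^sub>n\<^sub>+\<^sub>1 - A y\<^sub>n = B\<^sub>n x\<^sub>n\<close> says that the second component of \<open>y\<close> is the right
  shift of the first one, the condition \<open>y\<^sub>0 \<in> ran Q\<^sub>+\<close> being the boundary condition; the first row
  is then the equation \<open>(S - S\<^sup>-\<^sup>1 - \<lambda>) p = - b x\<close> for the first component \<open>p\<close>.\<close>

lemma T_plus_eq:
  assumes x: "x \<in> ell2"
  shows "T_plus b c l x = emb (K_plus b c l (\<lambda>n. x n $ 1))"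
proof -
  define f where "f = (\<lambda>m. b m * x m $ 1)"
  have f: "summable (\<lambda>n. norm (f n))"
    unfolding f_def by (intro ell2_mult_summable b nth_ell2 x)
  (* the sign comes from S\<^sup>-\<^sup>1 - A, which acts as minus S - S\<^sup>-\<^sup>1 - \<lambda> on first components *)
  define y where "y = (\<lambda>n. vector [- G f n, right_shift (\<lambda>n. - G f n) n] :: complex^2)"
  have "inv_into ell2_ran_Q (\<lambda>y m. left_shift y m - A_mat l *v y m) (\<lambda>m. scaled_Q (b m) *v x m) = y"
  proof (rule inv_into_f_eq)
    show "inj_on (\<lambda>y m. left_shift y m - A_mat l *v y m) ell2_ran_Q"
    proof (rule inj_onI)
      fix u w :: "nat \<Rightarrow> complex^2"
      assume uw: "u \<in> ell2_ran_Q" "w \<in> ell2_ran_Q"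
        "(\<lambda>m. left_shift u m - A_mat l *v u m) = (\<lambda>m. left_shift w m - A_mat l *v w m)"
      define d where "d = (\<lambda>n. u n - w n)"
      have d: "d \<in> ell2" unfolding d_def using uw(1,2) by (intro ell2_diff) (auto simp: ell2_ran_Q_def)
      have eq: "d (Suc m) = A_mat l *v d m" for m
        using fun_cong[OF uw(3), of m] by (simp add: d_def left_shift_def matrix_vector_mult_diff_distrib algebra_simps)
      have d0: "d 0 $ 2 = 0" using uw by (simp add: d_def ell2_ran_Q_def range_Q_plus)
      have rec: "d (Suc m) $ 1 = d m $ 2 - l * d m $ 1" "d (Suc m) $ 2 = d m $ 1" for m
        unfolding eq A_mat_mult_vec by simp_all
      have "right_shift (\<lambda>n. d n $ 1) m - left_shift (\<lambda>n. d n $ 1) m - l * d m $ 1 = 0" for m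
        using d0 rec[of m] by (cases m) (simp_all add: right_shift_def left_shift_def rec(2))
      then have 1: "d n $ 1 = 0" for n
        using homogeneous_ell2_zero[OF nth_ell2[OF d, of 1]] by blast
      have 2: "d n $ 2 = 0" for n using d0 by (cases n) (simp_all add: rec(2) 1)
      have "d n = 0" for n using 1 2 by (simp add: vec_eq_iff forall_2)
      then show "u = w" by (auto simp: d_def fun_eq_iff)
    qed
    have G: "(\<lambda>n. - G f n) \<in> ell2"
      using ell2I_summable_norm[OF summable_G[OF f]] by (simp add: ell2_def)
    have "right_shift (\<lambda>n. - G f n) \<in> ell2"
    proof -
      have "summable (\<lambda>n. (norm (right_shift (\<lambda>n. - G f n) (Suc n)))\<^sup>2)"
        using G by (simp add: ell2_def right_shift_def)
      then show ?thesis unfolding ell2_def mem_Collect_eq by (subst (asm) summable_Suc_iff)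
    qed
    then show "y \<in> ell2_ran_Q"
      using G by (auto simp: ell2_ran_Q_def range_Q_plus y_def ell2_def norm_vector2 right_shift_def intro: summable_add)
    show "(\<lambda>m. left_shift y m - A_mat l *v y m) = (\<lambda>m. scaled_Q (b m) *v x m)"
    proof
      fix m
      show "left_shift y m - A_mat l *v y m = scaled_Q (b m) *v x m"
        using G_right_inverse[OF f, of m]
        by (cases m) (simp_all add: vec_eq_iff forall_2 A_mat_mult_vec scaled_Q_mult_vec y_def left_shift_def right_shift_def f_def algebra_simps)
    qed
  qed
  then show ?thesis
    unfolding T_plus_def K_plus_eq[OF b c nth_ell2[OF x]]
    by (simp add: scaled_Q_mult_vec y_def emb_def f_def)
qed

lemma T_plus_trace_class: "trace_class inner_C2 (T_plus b c l)"
proof -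
  obtain f g :: "nat \<Rightarrow> nat \<Rightarrow> complex" where fg: "\<And>k. f k \<in> ell2" "\<And>k. g k \<in> ell2"
    "summable (\<lambda>k. ell2_norm (f k) * ell2_norm (g k))"
    "\<And>x y. x \<in> ell2 \<Longrightarrow> y \<in> ell2 \<Longrightarrow> (\<lambda>k. inner_C x (f k) * inner_C (g k) y) sums inner_C (K_plus b c l x) y"
    using K_plus_trace_class[OF b c] unfolding trace_class_def by blast
  have "\<forall>x\<in>ell2. T_plus b c l x \<in> ell2"
    by (simp add: T_plus_eq emb_ell2 K_plus_ell2[OF b c] nth_ell2)
  moreover have "\<forall>x\<in>ell2. \<forall>y\<in>ell2. (\<lambda>k. inner_C2 x (emb (f k)) * inner_C2 (emb (g k)) y) sums inner_C2 (T_plus b c l x) y"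
    by (simp add: T_plus_eq inner_C2_emb fg(4) nth_ell2)
  moreover have "\<forall>k. emb (f k) \<in> ell2 \<and> emb (g k) \<in> ell2" "summable (\<lambda>k. ell2_norm (emb (f k)) * ell2_norm (emb (g k)))"
    using fg by (auto simp: emb_ell2)
  ultimately show ?thesis
    unfolding trace_class_def
    by (intro conjI exI[of _ "\<lambda>k. emb (f k)"] exI[of _ "\<lambda>k. emb (g k)"])
qed

lemma T_plus_matrix:
  "inner_C2 (T_plus b c l (basis_C2 (j, q))) (basis_C2 (i, p)) =
    (if p = 1 then inner_C (K_plus b c l (if q = 1 then basis_C j else (\<lambda>n. 0))) (basis_C i) else 0)"
  by (simp add: T_plus_eq basis_C2_ell2 inner_C2_emb basis_C2_nth1) (simp add: inner_C_def)

text \<open>Minors over index sets that meet the second component vanish, as they contain a zero row; the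
  others are the minors of \<open>K\<^sub>\<lambda>\<^sup>+\<close>.\<close>

theorem det_T_plus_eq: "det_T_plus b c l = det_K_plus b c l"
proof -
  let ?MT = "\<lambda>i j. inner_C2 (T_plus b c l (basis_C2 j)) (basis_C2 i)"
  let ?MK = "\<lambda>i j. inner_C (K_plus b c l (basis_C j)) (basis_C i)"
  let ?e = "\<lambda>F. (\<lambda>n. (n, 1 :: 2)) ` F"
  have "trace_ext_power inner_C2 basis_C2 k (T_plus b c l) = trace_ext_power inner_C basis_C k (K_plus b c l)" for k
  proof -
    have inj: "inj_on ?e X" for X by (intro inj_onI) (auto simp: image_iff)
    have "(\<Sum>\<^sub>\<infinity>F\<in>{F. finite F \<and> card F = k}. principal_minor ?MT F) =
      (\<Sum>\<^sub>\<infinity>F\<in>?e ` {F. finite F \<and> card F = k}. principal_minor ?MT F)"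
    proof (rule infsum_cong_neutral)
      fix F :: "(nat \<times> 2) set"
      assume F: "F \<in> {F. finite F \<and> card F = k} - ?e ` {F. finite F \<and> card F = k}"
      have "\<exists>i\<in>F. snd i \<noteq> 1"
      proof (rule ccontr)
        assume no: "\<not> (\<exists>i\<in>F. snd i \<noteq> 1)"
        then have "\<And>i. i \<in> F \<Longrightarrow> i = (fst i, 1)" by (metis prod.collapse)
        then have "F = ?e (fst ` F)" by (auto simp: image_iff) force+
        moreover have "card (fst ` F) = card F"
          using no by (intro card_image inj_onI) (auto simp: prod_eq_iff)
        ultimately show False using F by blast
      qed
      then obtain i where "i \<in> F" "snd i \<noteq> 1" by blast
      then show "principal_minor ?MT F = 0"
        using F T_plus_matrix[of _ _ "fst i" "snd i"] by (intro principal_minor_zero_row[of F i]) auto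
    next
      fix F :: "(nat \<times> 2) set"
      assume "F \<in> ?e ` {F. finite F \<and> card F = k} - {F. finite F \<and> card F = k}"
      then show "principal_minor ?MT F = 0" by (auto simp: card_image inj_on_def)
    qed simp
    also have "\<dots> = (\<Sum>\<^sub>\<infinity>F\<in>{F. finite F \<and> card F = k}. principal_minor ?MT (?e F))"
      by (subst infsum_reindex[OF inj]) (simp add: o_def)
    also have "\<dots> = (\<Sum>\<^sub>\<infinity>F\<in>{F. finite F \<and> card F = k}. principal_minor ?MK F)"
      by (intro infsum_cong, subst principal_minor_image) (auto simp: inj_on_def T_plus_matrix)
    finally show ?thesis by (simp add: trace_ext_power_def)
  qed
  then show ?thesis
    using K_plus_trace_class[OF b c] T_plus_trace_class
    by (simp add: det_T_plus_def det_K_plus_def fredholm_det_I_minus_def)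
qed

end
end

section \<open>The characteristic root off the cut\<close>

text \<open>The root of \<open>\<mu>\<^sup>2 + \<lambda>\<mu> - 1 = 0\<close> in a form that is holomorphic off the whole cut: the usual
  \<open>(- \<lambda> + csqrt (\<lambda>\<^sup>2 + 4)) / 2\<close> jumps on the imaginary axis beyond \<open>\<plusminus>2i\<close>, while \<open>1 + 4 / \<lambda>\<^sup>2\<close> meets the branch
  cut of \<open>csqrt\<close> only for \<open>\<lambda>\<close> in \<open>[-2i, 2i]\<close>.\<close>

definition joukowski_root :: "complex \<Rightarrow> complex" where
  "joukowski_root l = l / 2 * (csqrt (1 + 4 / l\<^sup>2) - 1)"

lemma off_cut_nonzero: "l \<in> off_cut \<Longrightarrow> l \<noteq> 0"
proof
  assume "l \<in> off_cut" "l = 0"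
  moreover have "(0 :: complex) \<in> closed_segment (- 2 * \<i>) (2 * \<i>)"
    unfolding in_segment by (intro exI[of _ "1 / 2"]) (simp add: scaleR_conv_of_real)
  ultimately show False by (simp add: off_cut_def)
qed

lemma off_cut_not_nonpos:
  assumes "l \<in> off_cut"
  shows "1 + 4 / l\<^sup>2 \<notin> \<real>\<^sub>\<le>\<^sub>0"
proof
  assume "1 + 4 / l\<^sup>2 \<in> \<real>\<^sub>\<le>\<^sub>0"
  then obtain r where r: "1 + 4 / l\<^sup>2 = of_real r" "r \<le> 0" by (auto elim: nonpos_Reals_cases)
  have l0: "l \<noteq> 0" using off_cut_nonzero[OF assms] .
  have "4 = (of_real r - 1) * l\<^sup>2" using r(1) l0 by (simp add: field_simps)
  then have "of_real (r - 1) * l\<^sup>2 = 4" by simp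
  note eq = this
  have re: "(r - 1) * ((Re l)\<^sup>2 - (Im l)\<^sup>2) = 4"
    using arg_cong[OF eq, of Re] by (simp add: Re_power2)
  have im: "(r - 1) * (2 * Re l * Im l) = 0"
    using arg_cong[OF eq, of Im] by (simp add: Im_power2)
  have "Re l = 0"
  proof (rule ccontr)
    assume "Re l \<noteq> 0"
    then have "Im l = 0" using im r(2) by auto
    then have "(r - 1) * (Re l)\<^sup>2 = 4" using re by simp
    moreover have "(r - 1) * (Re l)\<^sup>2 \<le> 0" using r(2) by (intro mult_nonpos_nonneg) auto
    ultimately show False by simp
  qed
  then have "(1 - r) * (Im l)\<^sup>2 = 4" using re by (simp add: algebra_simps)
  moreover have "1 * (Im l)\<^sup>2 \<le> (1 - r) * (Im l)\<^sup>2" using r(2) by (intro mult_right_mono) auto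
  ultimately have "(Im l)\<^sup>2 \<le> 2\<^sup>2" by simp
  then have "\<bar>Im l\<bar> \<le> \<bar>2\<bar>" by (simp only: abs_le_square_iff[symmetric])
  then have "l \<in> closed_segment (- 2 * \<i>) (2 * \<i>)"
    unfolding in_segment using \<open>Re l = 0\<close>
    by (intro exI[of _ "(Im l + 2) / 4"]) (auto simp: complex_eq_iff field_simps abs_le_iff)
  then show False using assms by (simp add: off_cut_def)
qed

text \<open>The roots are \<open>\<lambda> (s - 1) / 2\<close> and \<open>- \<lambda> (s + 1) / 2\<close> for the square root \<open>s\<close>. Since
  \<open>Re s > 0\<close>, the first one is smaller in modulus, and the product of the roots is \<open>-1\<close>.\<close>

lemma char_root_joukowski:
  assumes "l \<in> off_cut"
  shows "char_root (joukowski_root l) l"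
proof -
  define s where "s = csqrt (1 + 4 / l\<^sup>2)"
  define m where "m = joukowski_root l"
  define k where "k = - (l / 2) * (1 + s)"
  have l0: "l \<noteq> 0" using off_cut_nonzero[OF assms] .
  have s2: "s\<^sup>2 = 1 + 4 / l\<^sup>2" by (simp add: s_def)
  have m: "m = l / 2 * (s - 1)" by (simp add: m_def joukowski_root_def s_def)
  have "Re s \<noteq> 0"
  proof
    assume "Re s = 0"
    then have "s\<^sup>2 = of_real (- (Im s)\<^sup>2)" by (simp add: complex_eq_iff Re_power2 Im_power2)
    then have "s\<^sup>2 \<in> \<real>\<^sub>\<le>\<^sub>0" by (metis neg_le_0_iff_le nonpos_Reals_of_real_iff zero_le_power2)
    then show False using off_cut_not_nonpos[OF assms] s2 by simp
  qed
  then have Re: "Re s > 0" using csqrt_principal[of "1 + 4 / l\<^sup>2"] by (auto simp: s_def)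
  have mk: "m * k = - 1"
  proof -
    have "m * k = - (l\<^sup>2 / 4) * (s\<^sup>2 - 1)" by (simp add: m k_def power2_eq_square field_simps)
    then show ?thesis using l0 by (simp add: s2)
  qed
  have mk': "m + k = - l" by (simp add: m k_def field_simps)
  have m0: "m \<noteq> 0" using mk by auto
  have "norm (s - 1) < norm (1 + s)"
    using Re by (simp add: cmod_def power2_eq_square algebra_simps)
  then have "norm m < norm k"
    using l0 by (simp add: m k_def norm_mult)
  have "norm m < 1"
  proof (rule ccontr)
    assume "\<not> norm m < 1"
    then have "1 \<le> norm m" by simp
    then have "1 * 1 < norm m * norm k" using \<open>norm m < norm k\<close> by (intro mult_le_less_imp_less) auto
    then show False using mk by (simp flip: norm_mult)
  qed
  moreover have "k = - 1 / m" using mk m0 by (simp add: field_simps)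
  then have "l = 1 / m - m" using mk' by (simp add: algebra_simps)
  ultimately have "char_root m l" using m0 by (intro char_root.intro)
  then show ?thesis unfolding m_def .
qed

lemma joukowski_root_holomorphic: "joukowski_root holomorphic_on off_cut"
  unfolding joukowski_root_def
  by (intro holomorphic_intros) (auto simp: off_cut_nonzero off_cut_not_nonpos)

section \<open>The Evans function, the Jost function and the eigenvalues\<close>

text \<open>A projection is determined by its range and its kernel: \<open>P'\<close> annihilates \<open>x - P x\<close> and fixes
  \<open>P x\<close>.\<close>

lemma projection_onto_along_eqI:
  assumes "P ** P = P" "range ((*v) P) = U" "{v. P *v v = 0} = V"
  shows "projection_onto_along U V = P"
  unfolding projection_onto_along_def
proof (rule the_equality)
  fix P' :: "complex^2^2"
  assume P': "P' ** P' = P' \<and> range ((*v) P') = U \<and> {v. P' *v v = 0} = V"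
  have "P' *v x = P *v x" for x
  proof -
    have "P *v (x - P *v x) = 0"
      using assms(1) by (simp add: matrix_vector_mult_diff_distrib matrix_vector_mul_assoc)
    then have "P' *v (x - P *v x) = 0" using P' assms(3) by blast
    then have "P' *v x = P' *v (P *v x)" by (simp add: matrix_vector_mult_diff_distrib)
    also obtain y where "P *v x = P' *v y" using P' assms(2) by blast
    then have "P' *v (P *v x) = P *v x" using P' by (simp add: matrix_vector_mul_assoc)
    finally show ?thesis .
  qed
  then show "P' = P" by (simp add: matrix_eq)
qed (use assms in auto)

lemma matrix_mult_2_nth:
  fixes M N :: "complex^2^2"
  shows "(M ** N) $ i $ j = M $ i $ 1 * N $ 1 $ j + M $ i $ 2 * N $ 2 $ j"
  by (simp add: matrix_matrix_mult_def sum_2)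

lemma mat_mult_nth:
  fixes N :: "complex^2^2"
  shows "(mat a ** N) $ i $ j = a * N $ i $ j"
proof -
  have "i = 1 \<or> i = 2" using exhaust_2 by blast
  then show ?thesis by (auto simp: matrix_mult_2_nth mat_def)
qed

lemma A_mat_mult_nth:
  fixes N :: "complex^2^2"
  shows "(A_mat l ** N) $ 1 $ j = N $ 2 $ j - l * N $ 1 $ j" "(A_mat l ** N) $ 2 $ j = N $ 1 $ j"
  by (simp_all add: matrix_mult_2_nth A_mat_def)

lemma scaled_Q_nth: "scaled_Q a $ i $ j = a * Q_plus $ i $ j"
  by (simp add: scaled_Q_def mat_mult_nth)

lemma A_cross_nth:
  "A_cross b c l n $ 1 $ 1 = b n * c n - l" "A_cross b c l n $ 1 $ 2 = 1"
  "A_cross b c l n $ 2 $ 1 = 1" "A_cross b c l n $ 2 $ 2 = 0"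
  by (simp_all add: A_cross_def A_mat_def matrix_mult_2_nth scaled_Q_nth Q_plus_def)

lemma solves_E_iff:
  "solves_E b c l z \<longleftrightarrow> z \<in> extensional {- 1..} \<and>
    char_root.three_term l (\<lambda>n. b n * c n) (\<lambda>k. z (int k - 1))"
  if "char_root \<mu> l"
proof -
  interpret char_root \<mu> l by fact
  have "z (int n - 1) - z (int n + 1) + b n * c n * z (int n) = l * z (int n) \<longleftrightarrow>
     z (int (Suc (Suc n)) - 1) = z (int n - 1) + (b n * c n - l) * z (int (Suc n) - 1)" for n
    by (auto simp: algebra_simps)
  then show ?thesis by (simp add: solves_E_def three_term_def)
qed

text \<open>Undoes the shift by one.\<close>

definition extend_left :: "(nat \<Rightarrow> complex) \<Rightarrow> int \<Rightarrow> complex" where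
  "extend_left s = (\<lambda>n. if n \<ge> - 1 then s (nat (n + 1)) else undefined)"

lemma extend_left: "extend_left s \<in> extensional {- 1..}" "extend_left s (int k - 1) = s k"
  by (auto simp: extend_left_def extensional_def)

lemma extend_left_eqI:
  assumes "z \<in> extensional {- 1..}" "\<And>k. z (int k - 1) = s k"
  shows "z = extend_left s"
proof
  fix n :: int
  show "z n = extend_left s n"
  proof (cases "n \<ge> - 1")
    case True
    then have "n = int (nat (n + 1)) - 1" by simp
    then show ?thesis using assms(2)[of "nat (n + 1)"] True by (simp add: extend_left_def)
  next
    case False
    then show ?thesis using assms(1) by (auto simp: extend_left_def extensional_def)
  qed
qed

lemma extend_left_nat: "extend_left s (int n) = s (Suc n)" "extend_left s (- 1) = s 0" "extend_left s 0 = s (Suc 0)"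
  by (auto simp: extend_left_def nat_add_distrib)

context char_root
begin

lemma root_iff: "m\<^sup>2 + l * m - 1 = 0 \<longleftrightarrow> m = \<mu> \<or> m = \<nu>"
proof -
  have "(m - \<mu>) * (m - \<nu>) = m\<^sup>2 + - (\<mu> + \<nu>) * m + \<mu> * \<nu>"
    by (simp add: power2_eq_square algebra_simps)
  moreover have "- (\<mu> + \<nu>) = l" by (simp add: l_eq \<nu>_def)
  ultimately have "(m - \<mu>) * (m - \<nu>) = m\<^sup>2 + l * m - 1" by (simp add: mu_nu)
  then show ?thesis by (metis eq_iff_diff_eq_0 mult_eq_0_iff)
qed

lemma norm_nu: "norm \<nu> > 1"
  using mu_less_1 mu_nz by (simp add: \<nu>_def norm_divide)

lemma mu_plus_eq: "mu_plus l = \<mu>"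
  unfolding mu_plus_def root_iff by (rule the_equality) (use mu_less_1 norm_nu in auto)

lemma mu_minus_eq: "mu_minus l = \<nu>"
  unfolding mu_minus_def root_iff by (rule the_equality) (use mu_less_1 norm_nu in auto)

lemma eigenspace: "{v. A_mat l *v v = \<mu> *s v} = {v. v $ 1 = \<mu> * v $ 2}"
  "{v. A_mat l *v v = \<nu> *s v} = {v. v $ 1 = \<nu> * v $ 2}"
proof -
  have "A_mat l *v v = m *s v \<longleftrightarrow> v $ 1 = m * v $ 2" if "m * m = 1 - l * m" for m and v :: "complex^2"
  proof -
    have "v $ 2 - l * (m * v $ 2) = m * m * v $ 2" by (simp add: that algebra_simps)
    then show ?thesis by (auto simp: A_mat_mult_vec vec_eq_iff forall_2 mult.assoc)
  qed
  then show "{v. A_mat l *v v = \<mu> *s v} = {v. v $ 1 = \<mu> * v $ 2}"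
    "{v. A_mat l *v v = \<nu> *s v} = {v. v $ 1 = \<nu> * v $ 2}"
    using mu_square nu_square by auto
qed

text \<open>The projection \<open>R\<^sub>+\<close> depends on \<open>P\<^sub>+\<close> only through its range, the line spanned by \<open>(\<mu>, 1)\<close>.\<close>

lemma range_P_plus: "range ((*v) (P_plus l)) = {v. v $ 1 = \<mu> * v $ 2}"
proof -
  let ?d = "\<mu> - \<nu>"
  (* the matrix (A - \<nu>) / (\<mu> - \<nu>) in components *)
  define P :: "complex^2^2" where "P = vector [vector [\<mu> / ?d, - (\<mu> * \<nu>) / ?d], vector [1 / ?d, - \<nu> / ?d]]"
  have Pv: "P *v x = vector [\<mu> * ((x $ 1 - \<nu> * x $ 2) / ?d), (x $ 1 - \<nu> * x $ 2) / ?d]" for x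
    by (simp add: P_def vec_eq_iff forall_2 matrix_vector_mult_def sum_2 right_diff_distrib diff_divide_distrib mult.assoc)
  have fixP: "P *v x = x" if "x $ 1 = \<mu> * x $ 2" for x :: "complex^2"
    using mu_neq_nu that by (simp add: Pv vec_eq_iff forall_2 left_diff_distrib[symmetric])
  have rng: "range ((*v) P) = {v. v $ 1 = \<mu> * v $ 2}"
  proof (intro set_eqI iffI)
    fix x :: "complex^2" assume "x \<in> {v. v $ 1 = \<mu> * v $ 2}"
    then have "x = P *v x" using fixP by simp
    then show "x \<in> range ((*v) P)" by blast
  qed (auto simp: Pv)
  have "P_plus l = P"
    unfolding P_plus_def mu_plus_eq mu_minus_eq eigenspace
  proof (rule projection_onto_along_eqI[OF _ rng])
    show "P ** P = P"
      unfolding matrix_eq matrix_vector_mul_assoc[symmetric]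
    proof
      fix x
      show "P *v (P *v x) = P *v x" by (rule fixP) (simp add: Pv)
    qed
    show "{v. P *v v = 0} = {v. v $ 1 = \<nu> * v $ 2}"
      using mu_neq_nu by (auto simp: Pv vec_eq_iff forall_2)
  qed
  then show ?thesis by (simp only: rng)
qed

lemma R_plus_eq: "R_plus l = vector [vector [0, \<mu>], vector [0, 1]]"
  unfolding R_plus_def range_P_plus range_Q_plus
proof (rule projection_onto_along_eqI)
  let ?R = "vector [vector [0, \<mu>], vector [0, 1]] :: complex^2^2"
  have Rv: "?R *v x = vector [\<mu> * x $ 2, x $ 2]" for x
    by (simp add: vec_eq_iff forall_2 matrix_vector_mult_def sum_2)
  show "?R ** ?R = ?R" by (simp add: vec_eq_iff forall_2 matrix_mult_2_nth)
  show "{v. ?R *v v = 0} = {x. x $ 2 = 0}" by (auto simp: Rv vec_eq_iff forall_2)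
  show "range ((*v) ?R) = {v. v $ 1 = \<mu> * v $ 2}"
  proof (intro set_eqI iffI)
    fix x :: "complex^2" assume "x \<in> {v. v $ 1 = \<mu> * v $ 2}"
    then have "x = ?R *v x" by (simp add: Rv vec_eq_iff forall_2)
    then show "x \<in> range ((*v) ?R)" by blast
  qed (auto simp: Rv)
qed

lemma A_mat_power_R_plus: "((\<lambda>M. A_mat l ** M) ^^ n) (R_plus l) = mat (\<mu> ^ n) ** R_plus l"
proof (induction n)
  case (Suc n)
  have "A_mat l ** (mat a ** R_plus l) = mat (\<mu> * a) ** R_plus l" for a
  proof -
    have "a - l * (a * \<mu>) = a * (1 - l * \<mu>)" by (simp add: algebra_simps)
    also have "\<dots> = \<mu> * a * \<mu>" unfolding mu_square[symmetric] by simp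
    finally show ?thesis
      by (simp add: vec_eq_iff forall_2 A_mat_mult_nth mat_mult_nth R_plus_eq)
  qed
  then show ?case using Suc by simp
qed (simp add: matrix_mul_lid)

lemma weighted_matrix_limit_iff:
  fixes Y :: "nat \<Rightarrow> complex^2^2"
  assumes col: "\<And>n i. Y n $ i $ 1 = 0"
  shows "(\<lambda>n. norm (mat (inverse \<mu> ^ n) ** (Y n - mat (\<mu> ^ n) ** R_plus l))) \<longlonglongrightarrow> 0 \<longleftrightarrow>
    (\<lambda>n. Y n $ 1 $ 2 / \<mu> ^ n - \<mu>) \<longlonglongrightarrow> 0 \<and> (\<lambda>n. Y n $ 2 $ 2 / \<mu> ^ n - 1) \<longlonglongrightarrow> 0"
proof -
  let ?M = "\<lambda>n. mat (inverse \<mu> ^ n) ** (Y n - mat (\<mu> ^ n) ** R_plus l)"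
  have M: "?M n = vector [vector [0, Y n $ 1 $ 2 / \<mu> ^ n - \<mu>], vector [0, Y n $ 2 $ 2 / \<mu> ^ n - 1]]" for n
    using mu_nz col by (simp add: vec_eq_iff forall_2 mat_mult_nth R_plus_eq power_inverse field_simps)
  show ?thesis
  proof
    assume "(\<lambda>n. norm (?M n)) \<longlonglongrightarrow> 0"
    then have "?M \<longlonglongrightarrow> 0" by (simp add: tendsto_norm_zero_iff)
    from tendsto_vec_nth[OF tendsto_vec_nth[OF this, of 1], of 2] tendsto_vec_nth[OF tendsto_vec_nth[OF this, of 2], of 2]
    show "(\<lambda>n. Y n $ 1 $ 2 / \<mu> ^ n - \<mu>) \<longlonglongrightarrow> 0 \<and> (\<lambda>n. Y n $ 2 $ 2 / \<mu> ^ n - 1) \<longlonglongrightarrow> 0"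
      unfolding M by simp
  next
    assume lims: "(\<lambda>n. Y n $ 1 $ 2 / \<mu> ^ n - \<mu>) \<longlonglongrightarrow> 0 \<and> (\<lambda>n. Y n $ 2 $ 2 / \<mu> ^ n - 1) \<longlonglongrightarrow> 0"
    have "(\<lambda>n. ?M n $ i $ j) \<longlonglongrightarrow> 0 $ i $ j" for i j
      using exhaust_2[of i] exhaust_2[of j] lims unfolding M by auto
    then have "?M \<longlonglongrightarrow> 0" by (intro vec_tendstoI)
    then show "(\<lambda>n. norm (?M n)) \<longlonglongrightarrow> 0" by (rule tendsto_norm_zero)
  qed
qed

context
  fixes b c :: "nat \<Rightarrow> complex"
  assumes v: "summable (\<lambda>n. norm (b n * c n))"
begin

abbreviation "z_plus \<equiv> jost_seq (\<lambda>n. b n * c n)"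

lemma jost_seq_limit: "(\<lambda>n. \<mu> * z_plus n / \<mu> ^ n - 1) \<longlonglongrightarrow> 0"
  using jost_seq_asymp[OF v] by (simp add: LIM_zero_iff mult.commute)

lemma jost_seq_Suc_limit: "(\<lambda>n. \<mu> * z_plus (Suc n) / \<mu> ^ n - \<mu>) \<longlonglongrightarrow> 0"
proof -
  have "(\<lambda>n. \<mu> * (\<mu> * z_plus (Suc n) / \<mu> ^ Suc n - 1)) \<longlonglongrightarrow> \<mu> * 0"
    by (intro tendsto_intros LIMSEQ_Suc[OF jost_seq_limit])
  then show ?thesis using mu_nz by (simp add: right_diff_distrib)
qed

text \<open>The condition \<open>Y\<^sub>0 = Y\<^sub>0 R\<^sub>+\<close> annihilates the first column of \<open>Y\<^sub>0\<close>, and the recurrence passes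
  this on to every \<open>Y\<^sub>n\<close>. The second column solves the first order system equivalent to (E), and its normalisation at infinity is \<open>\<mu>\<close> times
  that of the Jost solution.\<close>

lemma matrix_jost_eq:
  "matrix_jost b c l = (\<lambda>n. vector [vector [0, \<mu> * z_plus (Suc n)], vector [0, \<mu> * z_plus n]])"
  (is "_ = ?Y")
  unfolding matrix_jost_def mu_plus_eq A_mat_power_R_plus
proof (rule the_equality)
  show "(\<forall>n. ?Y (Suc n) = A_cross b c l n ** ?Y n) \<and>
    (\<lambda>n. norm (mat (inverse \<mu> ^ n) ** (?Y n - mat (\<mu> ^ n) ** R_plus l))) \<longlonglongrightarrow> 0 \<and> ?Y 0 = ?Y 0 ** R_plus l"
  proof (intro conjI allI)
    fix n
    show "?Y (Suc n) = A_cross b c l n ** ?Y n"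
      using three_termD[OF three_term_scale[OF three_term_jost[OF v], of \<mu>], of n]
      by (simp add: vec_eq_iff forall_2 matrix_mult_2_nth A_cross_nth)
  next
    show "?Y 0 = ?Y 0 ** R_plus l"
      by (simp add: vec_eq_iff forall_2 matrix_mult_2_nth R_plus_eq)
    show "(\<lambda>n. norm (mat (inverse \<mu> ^ n) ** (?Y n - mat (\<mu> ^ n) ** R_plus l))) \<longlonglongrightarrow> 0"
    proof (subst weighted_matrix_limit_iff)
      show "?Y n $ i $ 1 = 0" for n i using exhaust_2[of i] by auto
    qed (use jost_seq_limit jost_seq_Suc_limit in simp)
  qed
next
  fix Y assume Y: "(\<forall>n. Y (Suc n) = A_cross b c l n ** Y n) \<and>
    (\<lambda>n. norm (mat (inverse \<mu> ^ n) ** (Y n - mat (\<mu> ^ n) ** R_plus l))) \<longlonglongrightarrow> 0 \<and> Y 0 = Y 0 ** R_plus l"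
  have rec: "Y (Suc n) $ 1 $ j = (b n * c n - l) * Y n $ 1 $ j + Y n $ 2 $ j" "Y (Suc n) $ 2 $ j = Y n $ 1 $ j" for n j
    using Y[THEN conjunct1, rule_format, of n] by (simp_all add: matrix_mult_2_nth A_cross_nth)
  have Y0: "Y 0 $ i $ 1 = 0" for i
  proof -
    have "Y 0 $ i $ 1 = (Y 0 ** R_plus l) $ i $ 1"
      using arg_cong[OF Y[THEN conjunct2, THEN conjunct2], of "\<lambda>M. M $ i $ 1"] .
    then show ?thesis by (simp only: matrix_mult_2_nth) (simp add: R_plus_eq)
  qed
  have col1: "Y n $ 1 $ 1 = 0 \<and> Y n $ 2 $ 1 = 0" for n
    by (induction n) (simp_all add: Y0 rec)
  then have col1': "Y n $ i $ 1 = 0" for n i using exhaust_2[of i] by auto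
  have lim: "(\<lambda>n. Y n $ 2 $ 2 / \<mu> ^ n - 1) \<longlonglongrightarrow> 0"
    using Y weighted_matrix_limit_iff[of Y, OF col1'] by blast
  let ?s = "\<lambda>n. Y n $ 2 $ 2 - \<mu> * z_plus n"
  have "three_term (\<lambda>n. b n * c n) ?s"
  proof (intro three_term_diff three_term_scale three_term_jost v)
    show "three_term (\<lambda>n. b n * c n) (\<lambda>n. Y n $ 2 $ 2)"
      by (simp add: three_term_def rec)
  qed
  moreover have "(\<lambda>n. ?s n / \<mu> ^ n) \<longlonglongrightarrow> 0"
    using tendsto_diff[OF lim jost_seq_limit] by (simp add: diff_divide_distrib)
  ultimately have "?s n = 0" for n by (intro three_term_subdominant_unique[OF v])
  then have s: "Y n $ 2 $ 2 = \<mu> * z_plus n" for n by simp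
  then have "Y n $ 1 $ 2 = \<mu> * z_plus (Suc n)" for n unfolding rec(2)[of n 2, symmetric] .
  with s col1 show "Y = ?Y" by (auto simp: fun_eq_iff vec_eq_iff forall_2)
qed

lemma jost_seq_0: "z_plus 0 = jost_fun (\<lambda>n. b n * c n) / \<mu>"
  by (simp add: jost_seq_def)

theorem evans_plus_eq: "evans_plus b c l = jost_fun (\<lambda>n. b n * c n)"
  using mu_nz by (simp add: evans_plus_def matrix_jost_eq R_minus_def R_plus_eq det_2 mat_def jost_seq_0)

lemma jost_solution_eq: "jost_solution b c l = extend_left z_plus"
  unfolding jost_solution_def mu_plus_eq solves_E_iff[OF char_root_axioms]
proof (rule the_equality)
  have "(\<lambda>n. z_plus (Suc n) * \<mu> / \<mu> ^ Suc n) \<longlonglongrightarrow> 1"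
    by (rule LIMSEQ_Suc[OF jost_seq_asymp[OF v]])
  then have lim: "(\<lambda>n. z_plus (Suc n) / \<mu> ^ n) \<longlonglongrightarrow> 1" using mu_nz by simp
  then show "(extend_left z_plus \<in> extensional {- 1..} \<and> three_term (\<lambda>n. b n * c n) (\<lambda>k. extend_left z_plus (int k - 1))) \<and>
    (\<lambda>n. inverse \<mu> ^ n * extend_left z_plus (int n)) \<longlonglongrightarrow> 1"
    using three_term_jost[OF v] by (simp add: extend_left extend_left_nat power_inverse field_simps)
  fix z assume z: "(z \<in> extensional {- 1..} \<and> three_term (\<lambda>n. b n * c n) (\<lambda>k. z (int k - 1))) \<and>
    (\<lambda>n. inverse \<mu> ^ n * z (int n)) \<longlonglongrightarrow> 1"
  let ?s = "\<lambda>k. z (int k - 1) - z_plus k"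
  have "three_term (\<lambda>n. b n * c n) ?s"
    using z by (intro three_term_diff three_term_jost v) auto
  moreover have "(\<lambda>n. ?s n / \<mu> ^ n) \<longlonglongrightarrow> 0"
  proof (rule LIMSEQ_imp_Suc)
    have "(\<lambda>n. (inverse \<mu> ^ n * z (int n) - z_plus (Suc n) / \<mu> ^ n) / \<mu>) \<longlonglongrightarrow> (1 - 1) / \<mu>"
      using z mu_nz by (intro tendsto_intros lim) auto
    then show "(\<lambda>n. ?s (Suc n) / \<mu> ^ Suc n) \<longlonglongrightarrow> 0"
      using mu_nz by (simp add: power_inverse field_simps)
  qed
  ultimately have "?s n = 0" for n by (intro three_term_subdominant_unique[OF v])
  then show "z = extend_left z_plus" using z by (intro extend_left_eqI) auto
qed

lemma regular_solution_eq: "regular_solution b c l = extend_left (reg l (\<lambda>n. b n * c n))"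
  unfolding regular_solution_def solves_E_iff[OF char_root_axioms]
proof (rule the_equality)
  let ?r = "reg l (\<lambda>n. b n * c n)"
  show "(extend_left ?r \<in> extensional {- 1..} \<and> three_term (\<lambda>n. b n * c n) (\<lambda>k. extend_left ?r (int k - 1))) \<and>
    extend_left ?r (- 1) = 0 \<and> extend_left ?r 0 = 1"
    using three_term_reg by (simp add: extend_left extend_left_nat)
  fix z assume z: "(z \<in> extensional {- 1..} \<and> three_term (\<lambda>n. b n * c n) (\<lambda>k. z (int k - 1))) \<and>
    z (- 1) = 0 \<and> z 0 = 1"
  then show "z = extend_left ?r"
    using three_term_from_0[of "\<lambda>n. b n * c n" "\<lambda>k. z (int k - 1)"] by (intro extend_left_eqI) auto
qed

theorem jost_plus_eq: "jost_plus b c l = jost_fun (\<lambda>n. b n * c n)"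
  using mu_nz
  by (simp add: jost_plus_def wronskian_def mu_plus_eq jost_solution_eq regular_solution_eq extend_left_nat jost_seq_0)

lemma jost_seq_ell2: "z_plus \<in> ell2"
proof (rule ell2I_summable_norm)
  have "Bseq (\<lambda>n. z_plus n * \<mu> / \<mu> ^ n)"
    using jost_seq_asymp[OF v] by (intro convergent_imp_Bseq convergentI)
  then obtain K where K: "\<And>n. norm (z_plus n * \<mu> / \<mu> ^ n) \<le> K"
    unfolding Bseq_def by blast
  have "norm (z_plus n) \<le> K / norm \<mu> * norm \<mu> ^ n" for n
    using K[of n] mu_nz by (simp add: norm_divide norm_mult norm_power field_simps)
  moreover have "summable (\<lambda>n. K / norm \<mu> * norm \<mu> ^ n)"
    using mu_less_1 by (intro summable_mult summable_geometric) auto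
  ultimately show "summable (\<lambda>n. norm (z_plus n))"
    using summable_comparison_test'[of "\<lambda>n. K / norm \<mu> * norm \<mu> ^ n" 0 "\<lambda>n. norm (z_plus n)"] by simp
qed

text \<open>An eigenvector and the Jost solution both decay, so their Wronskian vanishes, and its value at
  the boundary is \<open>z\<^sub>0\<close> times \<open>z\<^sup>+\<^sub>-\<^sub>1\<close> up to sign. Conversely, if \<open>z\<^sup>+\<^sub>-\<^sub>1 = 0\<close>, then the Jost solution is
  an eigenvector, and it spans the eigenspace because solutions that vanish at \<open>-1\<close> are determined
  by one further value.\<close>

theorem simple_discrete_eigenvalue_iff:
  assumes "l \<in> off_cut"
  shows "simple_discrete_eigenvalue b c l \<longleftrightarrow> jost_fun (\<lambda>n. b n * c n) = 0"
proof
  assume "simple_discrete_eigenvalue b c l"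
  then obtain z u where z: "z \<in> ell2" "z \<noteq> (\<lambda>n. 0)" and u: "solves_E b c l u" "u (- 1) = 0" "\<And>n. u (int n) = z n"
    by (auto simp: simple_discrete_eigenvalue_def discrete_eigenvalue_def solution_space_def)
  define s where "s k = u (int k - 1)" for k
  have s: "three_term (\<lambda>n. b n * c n) s" "s 0 = 0" "\<And>n. s (Suc n) = z n"
    using u unfolding solves_E_iff[OF char_root_axioms] s_def by auto
  have "(\<lambda>n. s (Suc n)) \<longlonglongrightarrow> 0" using ell2_nth_tendsto_0[OF z(1)] by (simp add: s(3))
  then have "s \<longlonglongrightarrow> 0" by (rule LIMSEQ_imp_Suc)
  then have "s 0 * z_plus (Suc 0) - s (Suc 0) * z_plus 0 = 0"
    using three_term_casorati_0[OF s(1) three_term_jost[OF v], of 0] ell2_nth_tendsto_0[OF jost_seq_ell2] by simp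
  moreover have "s (Suc 0) \<noteq> 0"
  proof
    assume "s (Suc 0) = 0"
    then have "s n = 0" for n using three_term_from_0[OF s(1,2), of n] by simp
    then have "z = (\<lambda>n. 0)" by (intro ext) (simp flip: s(3))
    then show False using z(2) by simp
  qed
  ultimately show "jost_fun (\<lambda>n. b n * c n) = 0" using s(2) mu_nz by (simp add: jost_seq_0)
next
  assume "jost_fun (\<lambda>n. b n * c n) = 0"
  then have J0: "z_plus 0 = 0" by (simp add: jost_seq_0)
  have J1: "z_plus (Suc 0) \<noteq> 0"
  proof
    assume "z_plus (Suc 0) = 0"
    then have "z_plus n = 0" for n using three_term_from_0[OF three_term_jost[OF v] J0, of n] by simp
    then show False using jost_seq_asymp[OF v] by (simp add: LIMSEQ_const_iff)
  qed
  define w where "w n = z_plus (Suc n)" for n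
  have w: "w \<in> ell2"
    using jost_seq_ell2 summable_Suc_iff[of "\<lambda>n. (norm (z_plus n))\<^sup>2"] by (simp add: ell2_def w_def)
  have w0: "w \<noteq> (\<lambda>n. 0)" using J1 by (auto simp: w_def fun_eq_iff)
  have sp: "solution_space b c l = range (\<lambda>a n. a * w n)"
  proof (intro set_eqI iffI)
    fix z assume "z \<in> solution_space b c l"
    then obtain u where u: "solves_E b c l u" "u (- 1) = 0" "\<And>n. u (int n) = z n"
      by (auto simp: solution_space_def)
    have s: "three_term (\<lambda>n. b n * c n) (\<lambda>k. u (int k - 1))"
      using u(1) unfolding solves_E_iff[OF char_root_axioms] by auto
    have zw: "z n = z 0 / z_plus (Suc 0) * w n" for n
      using three_term_from_0[OF s, of "Suc n"] three_term_from_0[OF three_term_jost[OF v] J0, of "Suc n"] u u(3)[of 0] J1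
      by (simp add: w_def)
    have "z = (\<lambda>n. z 0 / z_plus (Suc 0) * w n)" by (rule ext) (rule zw)
    then show "z \<in> range (\<lambda>a n. a * w n)" by (rule range_eqI)
  next
    fix z assume "z \<in> range (\<lambda>a n. a * w n)"
    then obtain a where z: "z = (\<lambda>n. a * w n)" by auto
    have "three_term (\<lambda>n. b n * c n) (\<lambda>k. a * z_plus k)"
      by (intro three_term_scale three_term_jost v)
    then have "solves_E b c l (extend_left (\<lambda>k. a * z_plus k))"
      unfolding solves_E_iff[OF char_root_axioms] by (simp add: extend_left)
    moreover have "z \<in> ell2" using w by (simp add: z ell2_def norm_mult power_mult_distrib summable_mult)
    ultimately show "z \<in> solution_space b c l"
      unfolding solution_space_def by (auto simp: extend_left_nat z J0 w_def intro!: exI[of _ "extend_left (\<lambda>k. a * z_plus k)"])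
  qed
  have "w \<in> solution_space b c l" unfolding sp by (intro image_eqI[of _ _ 1]) auto
  then have "discrete_eigenvalue b c l" using assms w0 by (auto simp: discrete_eigenvalue_def)
  then show "simple_discrete_eigenvalue b c l"
    using w0 sp by (auto simp: simple_discrete_eigenvalue_def)
qed

end
end

section \<open>Holomorphic dependence on the spectral parameter\<close>

lemma ell2_holomorphic_nth:
  assumes "ell2_holomorphic_on f U"
  shows "(\<lambda>l. f l n) holomorphic_on U"
  unfolding holomorphic_on_def
proof
  fix w assume w: "w \<in> U"
  have fU: "\<And>v. v \<in> U \<Longrightarrow> f v \<in> ell2" using assms by (auto simp: ell2_holomorphic_on_def)
  from assms w obtain d where d: "d \<in> ell2"
    and lim: "((\<lambda>v. ell2_norm (\<lambda>n. (f v n - f w n) / (v - w) - d n)) \<longlongrightarrow> 0) (at w within U)"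
    by (auto simp: ell2_holomorphic_on_def)
  have "((\<lambda>v. (f v n - f w n) / (v - w) - d n) \<longlongrightarrow> 0) (at w within U)"
  proof (rule Lim_null_comparison[OF _ lim])
    show "\<forall>\<^sub>F v in at w within U. norm ((f v n - f w n) / (v - w) - d n) \<le> ell2_norm (\<lambda>n. (f v n - f w n) / (v - w) - d n)"
      unfolding eventually_at_filter
    proof (intro always_eventually allI impI)
      fix v assume "v \<in> U"
      have "(\<lambda>n. 1 / (v - w) * (f v n - f w n) - d n) \<in> ell2"
        by (intro ell2_diff ell2_scale fU w \<open>v \<in> U\<close> d)
      then show "norm ((f v n - f w n) / (v - w) - d n) \<le> ell2_norm (\<lambda>n. (f v n - f w n) / (v - w) - d n)"
        by (intro norm_nth_le_ell2_norm) simp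
    qed
  qed
  then have "((\<lambda>l. f l n) has_field_derivative d n) (at w within U)"
    by (simp add: has_field_derivative_iff LIM_zero_iff)
  then show "(\<lambda>l. f l n) field_differentiable at w within U" by (auto simp: field_differentiable_def)
qed

text \<open>Off \<open>w\<close> the difference is \<open>v - w\<close> times the difference quotient, whose norm stays bounded near
  \<open>w\<close> because it converges to that of the derivative.\<close>

lemma ell2_holomorphic_continuous:
  assumes "ell2_holomorphic_on f U" "w \<in> U" "e > 0"
  obtains \<delta> where "\<delta> > 0" "\<And>v. v \<in> U \<Longrightarrow> dist v w < \<delta> \<Longrightarrow> (\<Sum>n. (norm (f v n - f w n))\<^sup>2) \<le> e"
proof -
  have fU: "\<And>v. v \<in> U \<Longrightarrow> f v \<in> ell2" using assms by (auto simp: ell2_holomorphic_on_def)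
  from assms obtain d where d: "d \<in> ell2"
    and lim: "((\<lambda>v. ell2_norm (\<lambda>n. (f v n - f w n) / (v - w) - d n)) \<longlongrightarrow> 0) (at w within U)"
    by (auto simp: ell2_holomorphic_on_def)
  define D where "D = (\<Sum>n. (norm (d n))\<^sup>2)"
  have D: "D \<ge> 0" unfolding D_def using d by (intro suminf_nonneg) (auto simp: ell2_def)
  from lim have "\<forall>\<^sub>F v in at w within U. ell2_norm (\<lambda>n. (f v n - f w n) / (v - w) - d n) < 1"
    by (rule order_tendstoD) simp
  then obtain \<delta>1 where \<delta>1: "\<delta>1 > 0" "\<And>v. v \<in> U \<Longrightarrow> v \<noteq> w \<Longrightarrow> dist v w < \<delta>1 \<Longrightarrow>
     ell2_norm (\<lambda>n. (f v n - f w n) / (v - w) - d n) < 1"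
    unfolding eventually_at by blast
  define \<delta> where "\<delta> = min \<delta>1 (sqrt (e / (2 * D + 2)))"
  have "\<delta> > 0" using \<delta>1(1) assms(3) D by (simp add: \<delta>_def)
  moreover have "(\<Sum>n. (norm (f v n - f w n))\<^sup>2) \<le> e" if v: "v \<in> U" "dist v w < \<delta>" for v
  proof (cases "v = w")
    case False
    define q where "q = (\<lambda>n. (f v n - f w n) / (v - w))"
    have "(\<lambda>n. 1 / (v - w) * (f v n - f w n)) \<in> ell2"
      by (intro ell2_diff ell2_scale fU assms(2) v)
    then have q: "q \<in> ell2" by (simp add: q_def)
    have "ell2_norm (\<lambda>n. q n - d n) < 1" using \<delta>1(2)[of v] v False by (simp add: q_def \<delta>_def)
    then have "(ell2_norm (\<lambda>n. q n - d n))\<^sup>2 \<le> 1\<^sup>2"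
      by (intro power_mono) (auto simp: ell2_norm_def suminf_nonneg ell2_diff[OF q d, unfolded ell2_def mem_Collect_eq])
    then have "(\<Sum>n. (norm (q n - d n))\<^sup>2) \<le> 1" unfolding ell2_norm_square[OF ell2_diff[OF q d]] by simp
    then have qb: "(\<Sum>n. (norm (q n))\<^sup>2) \<le> 2 * D + 2"
      using ell2_tail_split[OF q d, of 0] by (simp add: D_def)
    have "(\<lambda>n. (norm (f v n - f w n))\<^sup>2) = (\<lambda>n. (norm (v - w))\<^sup>2 * (norm (q n))\<^sup>2)"
      using False by (simp add: q_def norm_divide power_divide)
    then have "(\<Sum>n. (norm (f v n - f w n))\<^sup>2) = (norm (v - w))\<^sup>2 * (\<Sum>n. (norm (q n))\<^sup>2)"
      using q by (simp add: suminf_mult ell2_def)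
    also have "\<dots> \<le> e / (2 * D + 2) * (2 * D + 2)"
    proof (intro mult_mono qb)
      have "norm (v - w) \<le> sqrt (e / (2 * D + 2))" using v(2) by (simp add: \<delta>_def dist_norm)
      then have "(norm (v - w))\<^sup>2 \<le> (sqrt (e / (2 * D + 2)))\<^sup>2" by (intro power_mono) auto
      then show "(norm (v - w))\<^sup>2 \<le> e / (2 * D + 2)" using assms(3) D by simp
    qed (use assms(3) D q in \<open>auto intro!: suminf_nonneg simp: ell2_def\<close>)
    finally show ?thesis using D by simp
  qed (use assms(3) in simp)
  ultimately show ?thesis using that by blast
qed

lemma uniform_limit_compact_if_locally:
  fixes F :: "nat \<Rightarrow> 'a::metric_space \<Rightarrow> 'b::metric_space"
  assumes K: "compact K"
    and loc: "\<And>w e. w \<in> K \<Longrightarrow> e > 0 \<Longrightarrow> \<exists>\<delta>>0. \<exists>N. \<forall>l\<in>K. dist l w < \<delta> \<longrightarrow> (\<forall>n\<ge>N. dist (F n l) (J l) < e)"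
  shows "uniform_limit K F J sequentially"
  unfolding uniform_limit_iff
proof (intro allI impI)
  fix e :: real assume "e > 0"
  then have "\<forall>w\<in>K. \<exists>p. fst p > 0 \<and> (\<forall>l\<in>K. dist l w < fst p \<longrightarrow> (\<forall>n\<ge>snd p. dist (F n l) (J l) < e))"
    using loc[of _ e] by simp
  from bchoice[OF this] obtain p where p: "\<forall>w\<in>K. fst (p w) > 0 \<and> (\<forall>l\<in>K. dist l w < fst (p w) \<longrightarrow> (\<forall>n\<ge>snd (p w). dist (F n l) (J l) < e))"
    by blast
  define \<delta> N where "\<delta> = fst \<circ> p" and "N = snd \<circ> p"
  have \<delta>: "\<And>w. w \<in> K \<Longrightarrow> \<delta> w > 0"
    and N: "\<And>w l n. w \<in> K \<Longrightarrow> l \<in> K \<Longrightarrow> dist l w < \<delta> w \<Longrightarrow> n \<ge> N w \<Longrightarrow> dist (F n l) (J l) < e"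
    using p by (auto simp: \<delta>_def N_def)
  have "K \<subseteq> (\<Union>w\<in>K. ball w (\<delta> w))" using \<delta> by auto
  then obtain D where D: "D \<subseteq> K" "finite D" "K \<subseteq> (\<Union>w\<in>D. ball w (\<delta> w))"
    using compactE_image[OF K, of K "\<lambda>w. ball w (\<delta> w)"] by auto
  have "\<forall>\<^sub>F n in sequentially. \<forall>w\<in>D. n \<ge> N w"
    using D(2) by (simp add: eventually_ball_finite_distrib eventually_ge_at_top)
  then show "\<forall>\<^sub>F n in sequentially. \<forall>l\<in>K. dist (F n l) (J l) < e"
  proof eventually_elim
    case (elim n)
    show ?case
    proof
      fix l assume "l \<in> K"
      then obtain w where "w \<in> D" "dist l w < \<delta> w" using D(3) by (auto simp: dist_commute)
      then show "dist (F n l) (J l) < e" using N[of w l n] D(1) elim \<open>l \<in> K\<close> by auto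
    qed
  qed
qed

lemma reg_holomorphic:
  assumes "\<And>n. (\<lambda>l. v l n) holomorphic_on U"
  shows "(\<lambda>l. reg l (v l) n) holomorphic_on U"
  by (induction n rule: induct_nat_012) (auto intro!: holomorphic_intros assms)

lemma open_off_cut: "open off_cut"
  unfolding off_cut_def by (intro open_Compl compact_imp_closed compact_segment)

context
  fixes b c :: "complex \<Rightarrow> nat \<Rightarrow> complex"
  assumes b: "ell2_holomorphic_on b off_cut" and c: "ell2_holomorphic_on c off_cut"
begin

abbreviation "potential l \<equiv> (\<lambda>n. b l n * c l n)"
abbreviation "jost_trunc_at n l \<equiv> char_root.jost_trunc (joukowski_root l) l (potential l) n"
abbreviation "jost_fun_at l \<equiv> char_root.jost_fun (joukowski_root l) l (potential l)"
abbreviation "C_at l \<equiv> char_root.C (joukowski_root l)"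

lemma b_ell2: "l \<in> off_cut \<Longrightarrow> b l \<in> ell2" and c_ell2: "l \<in> off_cut \<Longrightarrow> c l \<in> ell2"
  using b c by (auto simp: ell2_holomorphic_on_def)

lemma jost_trunc_holomorphic: "jost_trunc_at n holomorphic_on off_cut"
proof -
  have "(\<lambda>l. (- 1) ^ n * (joukowski_root l ^ n * reg l (potential l) (Suc n) - joukowski_root l ^ Suc n * reg l (potential l) n)) holomorphic_on off_cut"
    by (intro holomorphic_intros joukowski_root_holomorphic reg_holomorphic ell2_holomorphic_nth b c)
  then show ?thesis
    by (rule holomorphic_transform) (simp add: char_root.jost_trunc_def[OF char_root_joukowski])
qed

lemma C_continuous: "continuous_on off_cut C_at"
proof -
  have "joukowski_root l \<noteq> 0" "joukowski_root l - - (1 / joukowski_root l) \<noteq> 0" if "l \<in> off_cut" for l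
    using char_root.mu_nz[OF char_root_joukowski[OF that]] char_root.mu_neq_nu[OF char_root_joukowski[OF that]]
    by (auto simp: char_root.\<nu>_def[OF char_root_joukowski[OF that]])
  then have "continuous_on off_cut (\<lambda>l. 2 / norm (joukowski_root l - - (1 / joukowski_root l)))"
    by (intro continuous_intros holomorphic_on_imp_continuous_on[OF joukowski_root_holomorphic]) auto
  then show ?thesis
    by (rule continuous_on_eq) (simp add: char_root.C_def[OF char_root_joukowski] char_root.\<nu>_def[OF char_root_joukowski])
qed

lemma product_tail_le:
  assumes "l \<in> off_cut"
  shows "(\<Sum>n. norm (potential l (n + m))) \<le> (\<Sum>n. (norm (b l (n + m)))\<^sup>2) + (\<Sum>n. (norm (c l (n + m)))\<^sup>2)"
proof -
  have s: "summable (\<lambda>n. (norm (b l (n + m)))\<^sup>2)" "summable (\<lambda>n. (norm (c l (n + m)))\<^sup>2)"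
    using b_ell2[OF assms] c_ell2[OF assms] unfolding ell2_def mem_Collect_eq
    by (simp_all only: summable_iff_shift[of "\<lambda>n. (norm (b l n))\<^sup>2"] summable_iff_shift[of "\<lambda>n. (norm (c l n))\<^sup>2"])
  have "summable (\<lambda>n. norm (potential l (n + m)))"
    using ell2_mult_summable[OF b_ell2[OF assms] c_ell2[OF assms]] by (simp only: summable_iff_shift[of "\<lambda>n. norm (potential l n)"])
  then have "(\<Sum>n. norm (potential l (n + m))) \<le> (\<Sum>n. (norm (b l (n + m)))\<^sup>2 + (norm (c l (n + m)))\<^sup>2)"
    using mult_le_sum_squares by (intro suminf_le summable_add s) (simp add: norm_mult)
  then show ?thesis using s by (simp add: suminf_add)
qed

text \<open>By \<open>jost_fun_diff_bound\<close> it is enough to bound \<open>C\<close> and the \<open>\<ell>\<^sup>1\<close>-norm of the potential near \<open>w\<close>,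
  and to make the tail of the potential small, all uniformly in a neighbourhood of \<open>w\<close>.\<close>

lemma jost_trunc_locally_uniform:
  assumes w: "w \<in> off_cut" and e: "e > 0"
  shows "\<exists>\<delta>>0. \<exists>N. \<forall>l\<in>off_cut. dist l w < \<delta> \<longrightarrow> (\<forall>n\<ge>N. dist (jost_trunc_at n l) (jost_fun_at l) < e)"
proof -
  let ?q = "\<lambda>x m. \<Sum>n. (norm (x (n + m) :: complex))\<^sup>2"
  define V0 where "V0 = 2 * ?q (b w) 0 + 2 * ?q (c w) 0 + 4"
  define C0 where "C0 = C_at w + 1"
  (* the bound on the tail for which the estimate in jost_fun_diff_bound becomes e / 2 *)
  define \<tau> where "\<tau> = ln (1 + e / 2 * exp (- (C0 * V0))) / C0"
  have C0: "C0 > 0" using char_root.C_pos[OF char_root_joukowski[OF w]] by (simp add: C0_def)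
  have "1 + e / 2 * exp (- (C0 * V0)) > 1" using e by simp
  then have \<tau>: "\<tau> > 0" using C0 unfolding \<tau>_def by (intro divide_pos_pos ln_gt_zero) auto
  have \<tau>_eq: "exp (C0 * V0) * (exp (C0 * \<tau>) - 1) = e / 2"
  proof -
    have "exp (C0 * \<tau>) = 1 + e / 2 * exp (- (C0 * V0))"
      using C0 e by (simp add: \<tau>_def add_pos_pos)
    then show ?thesis by (simp flip: exp_add)
  qed
  obtain \<delta>1 where \<delta>1: "\<delta>1 > 0" "\<And>l. l \<in> off_cut \<Longrightarrow> dist l w < \<delta>1 \<Longrightarrow> (\<Sum>n. (norm (b l n - b w n))\<^sup>2) \<le> min 1 (\<tau> / 8)"
    using ell2_holomorphic_continuous[OF b w, of "min 1 (\<tau> / 8)"] \<tau> by auto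
  obtain \<delta>2 where \<delta>2: "\<delta>2 > 0" "\<And>l. l \<in> off_cut \<Longrightarrow> dist l w < \<delta>2 \<Longrightarrow> (\<Sum>n. (norm (c l n - c w n))\<^sup>2) \<le> min 1 (\<tau> / 8)"
    using ell2_holomorphic_continuous[OF c w, of "min 1 (\<tau> / 8)"] \<tau> by auto
  obtain \<delta>3 where \<delta>3: "\<delta>3 > 0" "\<And>l. l \<in> off_cut \<Longrightarrow> dist l w < \<delta>3 \<Longrightarrow> C_at l \<le> C0"
  proof -
    obtain d where "d > 0" "\<And>l. l \<in> off_cut \<Longrightarrow> dist l w < d \<Longrightarrow> dist (C_at l) (C_at w) < 1"
      using C_continuous w unfolding continuous_on_iff by (metis zero_less_one)
    then show ?thesis using that[of d] by (force simp: C0_def dist_real_def)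
  qed
  obtain N1 where N1: "\<And>m. m \<ge> N1 \<Longrightarrow> ?q (b w) m \<le> \<tau> / 8"
    using suminf_exist_split[of "\<tau> / 8" "\<lambda>n. (norm (b w n))\<^sup>2"] b_ell2[OF w] \<tau> by (force simp: ell2_def)
  obtain N2 where N2: "\<And>m. m \<ge> N2 \<Longrightarrow> ?q (c w) m \<le> \<tau> / 8"
    using suminf_exist_split[of "\<tau> / 8" "\<lambda>n. (norm (c w n))\<^sup>2"] c_ell2[OF w] \<tau> by (force simp: ell2_def)
  have "dist (jost_trunc_at m l) (jost_fun_at l) < e" if l: "l \<in> off_cut" "dist l w < min \<delta>1 (min \<delta>2 \<delta>3)" and m: "m \<ge> max N1 N2" for l m
  proof -
    interpret char_root "joukowski_root l" l by (rule char_root_joukowski[OF l(1)])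
    have sv: "summable (\<lambda>n. norm (potential l n))" by (intro ell2_mult_summable b_ell2 c_ell2 l)
    have Cl: "C \<le> C0" using \<delta>3(2)[OF l(1)] l(2) by simp
    have db: "(\<Sum>n. (norm (b l n - b w n))\<^sup>2) \<le> min 1 (\<tau> / 8)"
      by (rule \<delta>1(2)[OF l(1)]) (use l(2) in simp)
    have dc: "(\<Sum>n. (norm (c l n - c w n))\<^sup>2) \<le> min 1 (\<tau> / 8)"
      by (rule \<delta>2(2)[OF l(1)]) (use l(2) in simp)
    have bt: "?q (b l) k \<le> 2 * ?q (b w) k + 2 * min 1 (\<tau> / 8)" for k
      using ell2_tail_split[OF b_ell2[OF l(1)] b_ell2[OF w], of k] db by linarith
    have ct: "?q (c l) k \<le> 2 * ?q (c w) k + 2 * min 1 (\<tau> / 8)" for k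
      using ell2_tail_split[OF c_ell2[OF l(1)] c_ell2[OF w], of k] dc by linarith
    have V: "(\<Sum>n. norm (potential l n)) \<le> V0"
      using product_tail_le[OF l(1), of 0] bt[of 0] ct[of 0] by (simp add: V0_def)
    have T: "(\<Sum>n. norm (potential l (n + m))) \<le> \<tau>"
      using product_tail_le[OF l(1), of m] bt[of m] ct[of m] N1[of m] N2[of m] m by simp
    have V_nn: "0 \<le> (\<Sum>n. norm (potential l n))" using sv by (intro suminf_nonneg) auto
    have T_nn: "0 \<le> (\<Sum>n. norm (potential l (n + m)))"
      using summable_shift[OF sv, of m] by (intro suminf_nonneg) auto
    have "dist (jost_trunc_at m l) (jost_fun_at l) \<le> exp (C * (\<Sum>n. norm (potential l n))) * (exp (C * (\<Sum>n. norm (potential l (n + m)))) - 1)"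
      using jost_fun_diff_bound[OF sv, of m] by (simp add: dist_norm norm_minus_commute)
    also have "\<dots> \<le> exp (C0 * V0) * (exp (C0 * \<tau>) - 1)"
    proof (rule mult_mono)
      show "exp (C * (\<Sum>n. norm (potential l n))) \<le> exp (C0 * V0)"
        using mult_mono[OF Cl V] V_nn C0 by simp
      show "exp (C * (\<Sum>n. norm (potential l (n + m)))) - 1 \<le> exp (C0 * \<tau>) - 1"
        using mult_mono[OF Cl T] T_nn C0 by simp
      show "0 \<le> exp (C * (\<Sum>n. norm (potential l (n + m)))) - 1"
        using mult_nonneg_nonneg[OF less_imp_le[OF C_pos] T_nn] by simp
    qed simp
    finally show ?thesis using e by (simp add: \<tau>_eq)
  qed
  then show ?thesis using \<delta>1(1) \<delta>2(1) \<delta>3(1)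
    by (intro exI[of _ "min \<delta>1 (min \<delta>2 \<delta>3)"] conjI exI[of _ "max N1 N2"]) auto
qed

theorem jost_fun_holomorphic: "jost_fun_at holomorphic_on off_cut"
proof (rule holomorphic_uniform_sequence[OF open_off_cut jost_trunc_holomorphic])
  fix x assume "x \<in> off_cut"
  then obtain d where d: "d > 0" "cball x d \<subseteq> off_cut"
    using open_off_cut open_contains_cball by blast
  have "uniform_limit (cball x d) jost_trunc_at jost_fun_at sequentially"
  proof (rule uniform_limit_compact_if_locally)
    fix w and e :: real assume "w \<in> cball x d" "e > 0"
    then show "\<exists>\<delta>>0. \<exists>N. \<forall>l\<in>cball x d. dist l w < \<delta> \<longrightarrow> (\<forall>n\<ge>N. dist (jost_trunc_at n l) (jost_fun_at l) < e)"
      using jost_trunc_locally_uniform[of w e] d(2) by (meson subsetD)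
  qed simp
  then show "\<exists>d>0. cball x d \<subseteq> off_cut \<and> uniform_limit (cball x d) jost_trunc_at jost_fun_at sequentially"
    using d by blast
qed

end

section \<open>Equality of the four functions\<close>

theorem theorem1p1:
  fixes b c :: "complex \<Rightarrow> nat \<Rightarrow> complex"
  assumes "ell2_holomorphic_on b off_cut"
    and "ell2_holomorphic_on c off_cut"
  shows "(\<lambda>l. det_K_plus (b l) (c l) l) holomorphic_on off_cut \<and>
    (\<lambda>l. det_T_plus (b l) (c l) l) holomorphic_on off_cut \<and>
    (\<lambda>l. evans_plus (b l) (c l) l) holomorphic_on off_cut \<and>
    (\<lambda>l. jost_plus (b l) (c l) l) holomorphic_on off_cut \<and>
    (\<forall>l\<in>off_cut.
       det_K_plus (b l) (c l) l = det_T_plus (b l) (c l) l \<and>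
       det_T_plus (b l) (c l) l = evans_plus (b l) (c l) l \<and>
       evans_plus (b l) (c l) l = jost_plus (b l) (c l) l) \<and>
    (\<forall>l\<in>off_cut.
       simple_discrete_eigenvalue (b l) (c l) l \<longleftrightarrow>
         det_K_plus (b l) (c l) l = 0 \<and> det_T_plus (b l) (c l) l = 0 \<and>
         evans_plus (b l) (c l) l = 0 \<and> jost_plus (b l) (c l) l = 0)"
proof -
  let ?J = "\<lambda>l. char_root.jost_fun (joukowski_root l) l (\<lambda>n. b l n * c l n)"
  have eq: "det_K_plus (b l) (c l) l = ?J l" "det_T_plus (b l) (c l) l = ?J l"
    "evans_plus (b l) (c l) l = ?J l" "jost_plus (b l) (c l) l = ?J l"
    "simple_discrete_eigenvalue (b l) (c l) l \<longleftrightarrow> ?J l = 0"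
    if l: "l \<in> off_cut" for l
  proof -
    interpret char_root "joukowski_root l" l by (rule char_root_joukowski[OF l])
    have bc: "b l \<in> ell2" "c l \<in> ell2"
      using assms l by (auto simp: ell2_holomorphic_on_def)
    note v = ell2_mult_summable[OF bc]
    show "det_K_plus (b l) (c l) l = ?J l" by (rule det_K_plus_eq[OF bc])
    then show "det_T_plus (b l) (c l) l = ?J l" by (simp only: det_T_plus_eq[OF bc])
    show "evans_plus (b l) (c l) l = ?J l" by (rule evans_plus_eq[OF v])
    show "jost_plus (b l) (c l) l = ?J l" by (rule jost_plus_eq[OF v])
    show "simple_discrete_eigenvalue (b l) (c l) l \<longleftrightarrow> ?J l = 0"
      by (rule simple_discrete_eigenvalue_iff[OF v l])
  qed
  have hol: "f holomorphic_on off_cut" if "\<And>l. l \<in> off_cut \<Longrightarrow> f l = ?J l" for f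
    by (rule holomorphic_transform[OF jost_fun_holomorphic[OF assms]]) (simp add: that)
  show ?thesis
    by (intro conjI ballI hol) (simp_all add: eq)
qed

end
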